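(* Let $p\in[1,\infty]$ and $\frac1p+\frac1q=1$. Let $\sigma\in L^1_\alpha(\mathcal X)$, $\psi\in L^p_\alpha(\mathbb R^{d+1}_+)$ and $\varphi\in L^q_\alpha(\mathbb R^{d+1}_+)$. Then the two-wavelet localization operator $$\mathcal L_{\varphi,\psi}(\sigma):L^p_\alpha(\mathbb R^{d+1}_+)\longrightarrow L^p_\alpha(\mathbb R^{d+1}_+)$$ is compact.
   Context: Fix an integer $d\ge 1$ and a real $\alpha>-1/2$. Let $\mathbb R^{d+1}_+=\mathbb R^d\times(0,\infty)$, with points $x=(x',x_{d+1})$, equipped with the measure $$d\mu_\alpha(x)=\frac{x_{d+1}^{2\alpha+1}}{(2\pi)^d2^{2\alpha}\Gamma^2(\alpha+1)}\,dx.$$ For $1\le p\le\infty$, $L^p_\alpha(\mathbb R^{d+1}_+)$ is the $L^p$ space of complex-valued functions for $\mu_\alpha$, with norm $\|\cdot\|_{\alpha,p}$. Let $\mathcal X=\{(a,x): a>0,\ x\in\mathbb R^{d+1}_+\}$ with measure $d\mu_\alpha(a,x)=\frac{d\mu_\alpha(x)\,da}{a^{2\alpha+d+3}}$, and $L^p_\alpha(\mathcal X)$ the corresponding $L^p$ space. Generalized translation, for $x,y\in\mathbb R^{d+1}_+$: $$\tau^\alpha_x\varphi(y)=\frac{\Gamma(\alpha+1)}{\sqrt\pi\,\Gamma(\alpha+1/2)}\int_0^\pi\varphi\Big(x'+y',\sqrt{x_{d+1}^2+y_{d+1}^2+2x_{d+1}y_{d+1}\cos\theta}\Big)(\sin\theta)^{2\alpha}\,d\theta;$$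 it extends to a contraction on every $L^p_\alpha(\mathbb R^{d+1}_+)$. For $a>0$ put $\varphi_a(x)=a^{-(2\alpha+d+2)}\varphi(x/a)$ and $\varphi_{a,x}(y)=a^{\alpha+1+\frac d2}\,\tau^\alpha_x\varphi_a(y)$. Weinstein continuous wavelet transform (for $f$ and $\varphi$ in Lebesgue spaces with conjugate exponents): $$\Phi^W_\varphi(f)(a,x)=\int_{\mathbb R^{d+1}_+}f(y)\,\overline{\varphi_{a,x}(y)}\,d\mu_\alpha(y),\quad (a,x)\in\mathcal X.$$ Two-wavelet localization operator with symbol $\sigma$ (measurable on $\mathcal X$) and windows $\varphi,\psi$ (measurable on $\mathbb R^{d+1}_+$): $$\mathcal L_{\varphi,\psi}(\sigma)(f)(y)=\int_{\mathcal X}\sigma(a,x)\,\Phi^W_\varphi(f)(a,x)\,\psi_{a,x}(y)\,d\mu_\alpha(a,x),\quad y\in\mathbb R^{d+1}_+.$$ *)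

theory Defs
  imports
    "HOL-Analysis.Analysis"
    "HOL-Probability.Essential_Supremum"
begin

text \<open>
  Elements of the \<open>L\<^sup>p\<close> spaces are represented by Borel measurable functions; identification of
  functions that agree almost everywhere is expressed explicitly where it matters. The exponent
  ranges over \<^typ>\<open>ennreal\<close> so that \<open>p = \<infinity>\<close> is included.
\<close>

definition Lp_space :: "'a measure \<Rightarrow> ennreal \<Rightarrow> ('a \<Rightarrow> complex) set" where
  "Lp_space M p = {f \<in> borel_measurable M.
     if p = \<infinity> then esssup M (\<lambda>x. ennreal (norm (f x))) < \<infinity>
     else integrable M (\<lambda>x. norm (f x) powr enn2real p)}"

definition Lp_norm :: "'a measure \<Rightarrow> ennreal \<Rightarrow> ('a \<Rightarrow> complex) \<Rightarrow> real" where
  "Lp_norm M p f =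
     (if p = \<infinity> then enn2real (esssup M (\<lambda>x. ennreal (norm (f x))))
      else (LINT x|M. norm (f x) powr enn2real p) powr (1 / enn2real p))"

text \<open>
  A linear operator on \<open>L\<^sup>p\<close>, given on representatives: it has to be compatible with almost
  everywhere equality, and linearity is an identity in \<open>L\<^sup>p\<close>, hence holds almost everywhere.
\<close>

definition linear_operator_Lp ::
    "'a measure \<Rightarrow> ennreal \<Rightarrow> (('a \<Rightarrow> complex) \<Rightarrow> ('a \<Rightarrow> complex)) \<Rightarrow> bool" where
  "linear_operator_Lp M p T \<longleftrightarrow>
     (\<forall>f\<in>Lp_space M p. T f \<in> Lp_space M p) \<and>
     (\<forall>f\<in>Lp_space M p. \<forall>g\<in>Lp_space M p.
        (AE y in M. f y = g y) \<longrightarrow> (AE y in M. T f y = T g y)) \<and>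
     (\<forall>f\<in>Lp_space M p. \<forall>g\<in>Lp_space M p.
        AE y in M. T (\<lambda>x. f x + g x) y = T f y + T g y) \<and>
     (\<forall>c. \<forall>f\<in>Lp_space M p. AE y in M. T (\<lambda>x. c * f x) y = c * T f y)"

text \<open>Compactness: bounded sequences have images with norm convergent subsequences.\<close>

definition compact_operator_Lp ::
    "'a measure \<Rightarrow> ennreal \<Rightarrow> (('a \<Rightarrow> complex) \<Rightarrow> ('a \<Rightarrow> complex)) \<Rightarrow> bool" where
  "compact_operator_Lp M p T \<longleftrightarrow>
     linear_operator_Lp M p T \<and>
     (\<forall>f :: nat \<Rightarrow> 'a \<Rightarrow> complex.
        (\<forall>n. f n \<in> Lp_space M p) \<longrightarrow> (\<exists>C. \<forall>n. Lp_norm M p (f n) \<le> C) \<longrightarrow>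
        (\<exists>r g. strict_mono r \<and> g \<in> Lp_space M p \<and>
           (\<lambda>n. Lp_norm M p (\<lambda>y. T (f (r n)) y - g y)) \<longlonglongrightarrow> 0))"


text \<open>
  The dimension \<open>d \<ge> 1\<close> is \<open>CARD('d)\<close>, and a point \<open>x = (x', x\<^bsub>d+1\<^esub>)\<close> is a pair.
\<close>

definition half_space :: "((real ^ 'd::finite) \<times> real) set" where
  "half_space = {x. 0 < snd x}"

definition weinstein_measure :: "real \<Rightarrow> ((real ^ 'd::finite) \<times> real) measure" where
  "weinstein_measure \<alpha> = density (restrict_space lborel half_space)
     (\<lambda>x. ennreal (snd x powr (2 * \<alpha> + 1) /
        ((2 * pi) ^ CARD('d) * 2 powr (2 * \<alpha>) * (Gamma (\<alpha> + 1))\<^sup>2)))"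

definition weinstein_wavelet_measure ::
    "real \<Rightarrow> (real \<times> ((real ^ 'd::finite) \<times> real)) measure" where
  "weinstein_wavelet_measure \<alpha> =
     density (restrict_space lborel {0<..})
       (\<lambda>a. ennreal (1 / a powr (2 * \<alpha> + real CARD('d) + 3)))
     \<Otimes>\<^sub>M weinstein_measure \<alpha>"

text \<open>
  The integral over \<open>\<theta>\<close> runs over the open interval, on which the argument of \<open>\<phi>\<close> stays in the
  open half space. For an \<open>L\<^sup>p\<close> function it converges absolutely for almost every \<open>y\<close>, so the
  formula also gives the extension of the translation to \<open>L\<^sup>p\<close>.
\<close>

definition weinstein_translation ::
    "real \<Rightarrow> (real ^ 'd::finite) \<times> real \<Rightarrow> ((real ^ 'd) \<times> real \<Rightarrow> complex)
      \<Rightarrow> (real ^ 'd) \<times> real \<Rightarrow> complex" where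
  "weinstein_translation \<alpha> x \<phi> y =
     of_real (Gamma (\<alpha> + 1) / (sqrt pi * Gamma (\<alpha> + 1 / 2))) *
     (LBINT \<theta>=0..pi.
        \<phi> (fst x + fst y, sqrt ((snd x)\<^sup>2 + (snd y)\<^sup>2 + 2 * snd x * snd y * cos \<theta>)) *
        of_real (sin \<theta> powr (2 * \<alpha>)))"

definition weinstein_dilation ::
    "real \<Rightarrow> real \<Rightarrow> ((real ^ 'd::finite) \<times> real \<Rightarrow> complex) \<Rightarrow> (real ^ 'd) \<times> real \<Rightarrow> complex" where
  "weinstein_dilation \<alpha> a \<phi> x =
     of_real (a powr (- (2 * \<alpha> + real CARD('d) + 2))) * \<phi> (x /\<^sub>R a)"

definition weinstein_wavelet ::
    "real \<Rightarrow> ((real ^ 'd::finite) \<times> real \<Rightarrow> complex) \<Rightarrow> real \<Rightarrow> (real ^ 'd) \<times> real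
      \<Rightarrow> (real ^ 'd) \<times> real \<Rightarrow> complex" where
  "weinstein_wavelet \<alpha> \<phi> a x y =
     of_real (a powr (\<alpha> + 1 + real CARD('d) / 2)) *
     weinstein_translation \<alpha> x (weinstein_dilation \<alpha> a \<phi>) y"

definition weinstein_transform ::
    "real \<Rightarrow> ((real ^ 'd::finite) \<times> real \<Rightarrow> complex) \<Rightarrow> ((real ^ 'd) \<times> real \<Rightarrow> complex)
      \<Rightarrow> real \<times> ((real ^ 'd) \<times> real) \<Rightarrow> complex" where
  "weinstein_transform \<alpha> \<phi> f = (\<lambda>(a, x).
     LINT y|weinstein_measure \<alpha>. f y * cnj (weinstein_wavelet \<alpha> \<phi> a x y))"

definition localization_operator ::
    "real \<Rightarrow> ((real ^ 'd::finite) \<times> real \<Rightarrow> complex) \<Rightarrow> ((real ^ 'd) \<times> real \<Rightarrow> complex)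
      \<Rightarrow> (real \<times> ((real ^ 'd) \<times> real) \<Rightarrow> complex)
      \<Rightarrow> ((real ^ 'd) \<times> real \<Rightarrow> complex) \<Rightarrow> (real ^ 'd) \<times> real \<Rightarrow> complex" where
  "localization_operator \<alpha> \<phi> \<psi> \<sigma> f y =
     (LINT (a, x)|weinstein_wavelet_measure \<alpha>.
        \<sigma> (a, x) * weinstein_transform \<alpha> \<phi> f (a, x) * weinstein_wavelet \<alpha> \<psi> a x y)"

end

theory Submission
  imports Defs "HOL-Library.Diagonal_Subsequence"
begin

text \<open>
  The localization operator is a superposition \<open>T f = \<integral> \<sigma>(\<xi>) \<langle>f, \<phi>\<^sub>\<xi>\<rangle> \<psi>\<^sub>\<xi> d\<xi>\<close> of rank-one operators,
  \<open>\<xi> = (a, x)\<close>. The generalized translation is bounded on every \<open>L\<^sup>p\<close>, and the dilations act by powers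
  of \<open>a\<close>; for conjugate exponents the powers for the two windows cancel, so both families of wavelets
  can be normalised to be bounded, in \<open>L\<^sup>q\<close> and in \<open>L\<^sup>p\<close>, without changing \<open>T\<close>. As \<open>\<sigma>\<close> is integrable, \<open>T\<close> is bounded, with
  \<open>|T f(y)| \<le> K G(y)\<close>, where \<open>K\<close> depends on \<open>f\<close> only through its norm and \<open>G = \<integral> |\<sigma>(\<xi>)| |\<psi>\<^sub>\<xi>| d\<xi>\<close> is in \<open>L\<^sup>p\<close>.

  Compactness comes from sequential weak-* compactness of balls in \<open>L\<^sup>\<infinity>\<close> of a \<open>\<sigma>\<close>-finite, countably
  generated measure space (\<open>weak_star_subsequence\<close>), used on one of the two sides of the
  factorization \<open>f \<mapsto> (\<xi> \<mapsto> \<langle>f, \<phi>\<^sub>\<xi>\<rangle>) \<mapsto> T f\<close>. If \<open>p < \<infinity>\<close>, the coefficients of a bounded sequence \<open>f\<^sub>n\<close> are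
  bounded functions of \<open>\<xi>\<close>. Along a subsequence they converge weak-*, hence \<open>T f\<^sub>n\<close> converges at
  almost every \<open>y\<close>, and dominated convergence with the majorant \<open>G\<close> gives convergence in \<open>L\<^sup>p\<close>. If
  \<open>p = \<infinity>\<close>, then \<open>\<phi>\<^sub>\<xi>\<close> is in \<open>L\<^sup>1\<close> and the \<open>f\<^sub>n\<close> themselves have a weak-* convergent subsequence. Its
  coefficients converge at every \<open>\<xi>\<close>, and dominated convergence in \<open>\<xi>\<close> makes \<open>T f\<^sub>n\<close> converge
  uniformly outside null sets.
  Both cases are combined in \<open>superposition_compact\<close>.

  The boundedness of the translation (\<open>nn_integral_weinstein_translation\<close>) rests on reading \<open>(y, \<theta>)\<close> as
  polar coordinates of a half-plane with the measure \<open>v\<^bsup>2\<alpha>\<^esup> du dv\<close>, in which the generalized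
  translation is an ordinary shift of \<open>u\<close>.
\<close>

section \<open>Weak-* sequential compactness of bounded functions\<close>

lemma convergent_subsequences_countable:
  fixes z :: "nat \<Rightarrow> nat \<Rightarrow> complex"
  assumes bdd: "\<And>k n. norm (z k n) \<le> B k"
  shows "\<exists>r. strict_mono r \<and> (\<forall>k. convergent (\<lambda>n. z k (r n)))"
proof -
  interpret subseqs "\<lambda>k s. convergent (\<lambda>n. z k (s n))"
  proof
    fix k and s :: "nat \<Rightarrow> nat"
    assume "strict_mono s"
    have "bounded (range (\<lambda>n. z k (s n)))"
      using bdd by (auto simp: bounded_iff)
    then obtain l r where "strict_mono r" "((\<lambda>n. z k (s n)) \<circ> r) \<longlonglongrightarrow> l"
      using bounded_imp_convergent_subsequence by blast
    then show "\<exists>r'. strict_mono r' \<and> convergent (\<lambda>n. z k ((s \<circ> r') n))"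
      by (auto simp: convergent_def o_def)
  qed
  have "convergent (\<lambda>n. z k (diagseq n))" for k
  proof -
    have "convergent (\<lambda>n. z k ((diagseq \<circ> (+) (Suc k)) n))"
    proof (rule diagseq_holds)
      fix r s :: "nat \<Rightarrow> nat" and m
      assume "strict_mono r" "convergent (\<lambda>n. z m (s n))"
      then show "convergent (\<lambda>n. z m ((s \<circ> r) n))"
        using convergent_subseq_convergent[of "\<lambda>n. z m (s n)" r] by (simp add: o_def)
    qed
    then have "convergent (\<lambda>n. z k (diagseq (n + Suc k)))"
      by (simp add: o_def add.commute)
    then show ?thesis
      by (subst (asm) convergent_ignore_initial_segment)
  qed
  then show ?thesis using subseq_diagseq by blast
qed

lemma integrable_mult_AE_bounded:
  fixes h u :: "'a \<Rightarrow> complex"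
  assumes h: "integrable M h" and [measurable]: "u \<in> borel_measurable M"
    and bdd: "AE x in M. norm (u x) \<le> C"
  shows "integrable M (\<lambda>x. h x * u x)"
    and "norm (\<integral>x. h x * u x \<partial>M) \<le> C * (\<integral>x. norm (h x) \<partial>M)"
proof -
  have [measurable]: "h \<in> borel_measurable M" using h by simp
  have ae: "AE x in M. norm (h x * u x) \<le> norm (C * norm (h x))"
    using bdd
  proof eventually_elim
    case (elim x)
    have "norm (h x) * norm (u x) \<le> norm (h x) * C" using elim by (rule mult_left_mono) simp
    then show ?case by (simp add: norm_mult mult.commute)
  qed
  show int: "integrable M (\<lambda>x. h x * u x)"
    by (rule Bochner_Integration.integrable_bound[OF _ _ ae]) (use h in auto)
  have "norm (\<integral>x. h x * u x \<partial>M) \<le> (\<integral>x. norm (h x * u x) \<partial>M)"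
    by simp
  also have "\<dots> \<le> (\<integral>x. C * norm (h x) \<partial>M)"
  proof (rule integral_mono_AE)
    show "AE x in M. norm (h x * u x) \<le> C * norm (h x)"
      using bdd by eventually_elim (simp add: norm_mult mult.commute[of C] mult_left_mono)
  qed (use h int in auto)
  finally show "norm (\<integral>x. h x * u x \<partial>M) \<le> C * (\<integral>x. norm (h x) \<partial>M)" by simp
qed

text \<open>
  The integrals \<open>\<integral> h u\<^sub>n\<close> are Lipschitz in \<open>h\<close> for the \<open>L\<^sup>1\<close> norm, uniformly in \<open>n\<close>, because the \<open>u\<^sub>n\<close>
  share an \<open>L\<^sup>\<infinity>\<close> bound. Hence the test functions \<open>h\<close> against which they converge form a closed
  subspace of \<open>L\<^sup>1\<close>; the two density arguments below use exactly this.
\<close>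

lemma convergent_integrals_L1_closed:
  fixes u :: "nat \<Rightarrow> 'a \<Rightarrow> complex"
  assumes [measurable]: "\<And>n. u n \<in> borel_measurable M"
    and bdd: "\<And>n. AE x in M. norm (u n x) \<le> C"
    and h: "integrable M h"
    and k: "\<And>i. integrable M (k i)" "\<And>i::nat. convergent (\<lambda>n. \<integral>x. k i x * u n x \<partial>M)"
    and lim: "(\<lambda>i. \<integral>x. norm (h x - k i x) \<partial>M) \<longlonglongrightarrow> 0"
  shows "convergent (\<lambda>n. \<integral>x. h x * u n x \<partial>M)"
proof (rule Cauchy_convergent, rule metric_CauchyI)
  fix e :: real assume "0 < e"
  define D where "D = 3 * (\<bar>C\<bar> + 1)"
  have "0 < e / D" using \<open>0 < e\<close> by (simp add: D_def add_nonneg_pos)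
  then obtain i where i: "(\<integral>x. norm (h x - k i x) \<partial>M) < e / D"
    using lim[THEN LIMSEQ_D, of "e / D"] by fastforce
  have app: "norm ((\<integral>x. h x * u n x \<partial>M) - (\<integral>x. k i x * u n x \<partial>M)) < e / 3" for n
  proof -
    have "(\<integral>x. h x * u n x \<partial>M) - (\<integral>x. k i x * u n x \<partial>M) = (\<integral>x. (h x - k i x) * u n x \<partial>M)"
      using integrable_mult_AE_bounded(1)[OF h _ bdd[of n]]
        integrable_mult_AE_bounded(1)[OF k(1) _ bdd[of n]]
      by (simp add: left_diff_distrib)
    also have "norm \<dots> \<le> C * (\<integral>x. norm (h x - k i x) \<partial>M)"
      by (rule integrable_mult_AE_bounded(2)) (use h k bdd in auto)
    also have "\<dots> \<le> (\<bar>C\<bar> + 1) * (\<integral>x. norm (h x - k i x) \<partial>M)"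
      by (intro mult_right_mono) auto
    also have "\<dots> < (\<bar>C\<bar> + 1) * (e / D)"
      using i by (intro mult_strict_left_mono) auto
    also have "\<dots> = e / 3" by (simp add: D_def field_simps add_nonneg_eq_0_iff)
    finally show ?thesis .
  qed
  have "Cauchy (\<lambda>n. \<integral>x. k i x * u n x \<partial>M)" using k(2) convergent_Cauchy by blast
  then obtain N where N: "\<And>m n. N \<le> m \<Longrightarrow> N \<le> n \<Longrightarrow>
      dist (\<integral>x. k i x * u m x \<partial>M) (\<integral>x. k i x * u n x \<partial>M) < e / 3"
    using metric_CauchyD[of _ "e / 3"] \<open>0 < e\<close> by fastforce
  have "dist (\<integral>x. h x * u m x \<partial>M) (\<integral>x. h x * u n x \<partial>M) < e" if "N \<le> m" "N \<le> n" for m n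
  proof -
    have "dist (\<integral>x. h x * u m x \<partial>M) (\<integral>x. k i x * u m x \<partial>M) < e / 3"
      "dist (\<integral>x. h x * u n x \<partial>M) (\<integral>x. k i x * u n x \<partial>M) < e / 3"
      using app by (auto simp: dist_norm)
    then show ?thesis using N[OF that] by metric
  qed
  then show "\<exists>N. \<forall>m\<ge>N. \<forall>n\<ge>N. dist (\<integral>x. h x * u m x \<partial>M) (\<integral>x. h x * u n x \<partial>M) < e"
    by blast
qed

text \<open>
  A diagonal argument makes \<open>\<integral>\<^sub>A u\<^sub>n\<close> converge for every \<open>A\<close> in a countable \<open>\<pi>\<close>-system that generates
  the \<open>\<sigma>\<close>-algebra. The sets \<open>A\<close> for which this holds form a Dynkin system: countable disjoint
  unions are limits in \<open>L\<^sup>1\<close> of finite ones, since the measure is finite. So all measurable sets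
  are reached, then simple functions, then \<open>L\<^sup>1\<close>. Stating the conclusion for the
  integrals, without naming a limit of the \<open>u\<^sub>n\<close>, avoids the duality between
  \<open>L\<^sup>1\<close> and \<open>L\<^sup>\<infinity>\<close>.
\<close>

lemma weak_star_subsequence_finite:
  fixes u :: "nat \<Rightarrow> 'a \<Rightarrow> complex"
  assumes "finite_measure M"
    and G: "countable G" "Int_stable G" "G \<subseteq> Pow (space M)" "sets M = sigma_sets (space M) G"
    and [measurable]: "\<And>n. u n \<in> borel_measurable M"
    and bdd: "\<And>n. AE x in M. norm (u n x) \<le> C"
  shows "\<exists>r. strict_mono r \<and> (\<forall>h. integrable M h \<longrightarrow> convergent (\<lambda>n. \<integral>x. h x * u (r n) x \<partial>M))"
proof -
  interpret finite_measure M by fact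
  \<comment> \<open>The whole space joins the generator because it enters the complement step of the Dynkin argument.\<close>
  define E where "E = from_nat_into (insert (space M) G)"
  have E: "range E = insert (space M) G"
    unfolding E_def using G(1) by (intro range_from_nat_into) auto
  have Es [measurable]: "E k \<in> sets M" for k
  proof -
    have "E k \<in> insert (space M) G" using E by blast
    then show ?thesis using G(4) by auto
  qed
  have ind: "integrable M (\<lambda>x. indicator A x :: complex)" if "A \<in> sets M" for A
    using that by (intro integrable_const_bound[where B=1]) (auto simp: indicator_def)
  have "\<exists>r. strict_mono r \<and> (\<forall>k. convergent (\<lambda>n. \<integral>x. indicator (E k) x * u (r n) x \<partial>M))"
    using convergent_subsequences_countable[of "\<lambda>k n. \<integral>x. indicator (E k) x * u n x \<partial>M"
        "\<lambda>k. C * (\<integral>x. norm (indicator (E k) x :: complex) \<partial>M)"]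
      integrable_mult_AE_bounded(2)[OF ind[OF Es] _ bdd] by simp
  then obtain r where r: "strict_mono r"
    and rE: "\<And>k. convergent (\<lambda>n. \<integral>x. indicator (E k) x * u (r n) x \<partial>M)" by blast
  let ?P = "\<lambda>h. convergent (\<lambda>n. \<integral>x. h x * u (r n) x \<partial>M)"
  have int_u: "integrable M (\<lambda>x. h x * u (r n) x)" if "integrable M h" for h n
    using integrable_mult_AE_bounded(1)[OF that _ bdd] by simp
  have P_add: "?P (\<lambda>x. h x + k x)" if "integrable M h" "integrable M k" "?P h" "?P k" for h k
    using convergent_add[OF that(3,4)] int_u[OF that(1)] int_u[OF that(2)]
    by (simp add: distrib_right)
  have sets_P: "?P (indicator A)" if "A \<in> sets M" for A
  proof -
    have "A \<in> sigma_sets (space M) G" using that G(4) by simp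
    with G(2,3) show ?thesis
    proof (induction rule: sigma_sets_induct_disjoint)
      case (basic A)
      then obtain k where "A = E k" using E by (metis insertCI rangeE)
      then show ?case using rE by simp
    next
      case empty
      then show ?case by (simp add: convergent_const)
    next
      case (compl A)
      then have A: "A \<in> sets M" using G(4) by simp
      obtain k where k: "space M = E k" using E by (metis insertCI rangeE)
      have eq: "(\<integral>x. indicator (space M - A) x * u (r n) x \<partial>M) =
          (\<integral>x. indicator (space M) x * u (r n) x \<partial>M) - (\<integral>x. indicator A x * u (r n) x \<partial>M)" for n
      proof -
        have "(\<integral>x. indicator (space M - A) x * u (r n) x \<partial>M) =
            (\<integral>x. indicator (space M) x * u (r n) x - indicator A x * u (r n) x \<partial>M)"
          using sets.sets_into_space[OF A]
          by (intro Bochner_Integration.integral_cong) (auto split: split_indicator)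
        also have "\<dots> = (\<integral>x. indicator (space M) x * u (r n) x \<partial>M) - (\<integral>x. indicator A x * u (r n) x \<partial>M)"
          by (rule Bochner_Integration.integral_diff[OF int_u[OF ind[OF sets.top]] int_u[OF ind[OF A]]])
        finally show ?thesis .
      qed
      show ?case unfolding eq using convergent_diff[OF rE[of k, folded k] compl(2)] .
    next
      case (union A)
      have As [measurable]: "A i \<in> sets M" for i using union(2) G(4) by auto
      have fin: "?P (indicator (\<Union>i<m. A i))" for m
      proof (induction m)
        case 0
        then show ?case by (simp add: convergent_const)
      next
        case (Suc m)
        have dis: "(\<Union>i<m. A i) \<inter> A m = {}"
        proof -
          have "A i \<inter> A m = {}" if "i < m" for i
            using disjoint_family_onD[OF union(1), of i m] that by simp
          then show ?thesis by blast
        qed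
        have "indicator (\<Union>i<Suc m. A i) =
            (\<lambda>x. indicator (\<Union>i<m. A i) x + (indicator (A m) x :: complex))"
        proof
          fix x
          have "(\<Union>i<Suc m. A i) = (\<Union>i<m. A i) \<union> A m" by (auto simp: lessThan_Suc)
          then show "indicator (\<Union>i<Suc m. A i) x =
              indicator (\<Union>i<m. A i) x + (indicator (A m) x :: complex)"
            using dis by (auto simp: indicator_def)
        qed
        moreover have "?P (\<lambda>x. indicator (\<Union>i<m. A i) x + indicator (A m) x)"
          by (rule P_add[OF ind ind Suc union(3)]) auto
        ultimately show ?case by simp
      qed
      show ?case
      proof (rule convergent_integrals_L1_closed[where k="\<lambda>m. indicator (\<Union>i<m. A i)" and C=C])
        have "(\<lambda>m. \<integral>x. norm (indicator (\<Union>i. A i) x - indicator (\<Union>i<m. A i) x :: complex) \<partial>M)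
            \<longlonglongrightarrow> (\<integral>x. 0 \<partial>M)"
        proof (rule integral_dominated_convergence[where w="\<lambda>_. 1"])
          show "AE x in M. (\<lambda>m. norm (indicator (\<Union>i. A i) x - indicator (\<Union>i<m. A i) x :: complex))
              \<longlonglongrightarrow> 0"
          proof (rule AE_I2)
            fix x
            have "\<forall>\<^sub>F m in sequentially. norm (indicator (\<Union>i. A i) x - indicator (\<Union>i<m. A i) x :: complex) = 0"
            proof (cases "x \<in> (\<Union>i. A i)")
              case True
              then obtain i where "x \<in> A i" by blast
              then show ?thesis
                by (intro eventually_sequentiallyI[of "Suc i"]) (auto simp: indicator_def)
            qed (auto simp: indicator_def)
            then show "(\<lambda>m. norm (indicator (\<Union>i. A i) x - indicator (\<Union>i<m. A i) x :: complex)) \<longlonglongrightarrow> 0"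
              by (rule tendsto_eventually)
          qed
        qed (auto simp: indicator_def)
        then show "(\<lambda>m. \<integral>x. norm (indicator (\<Union>i. A i) x - indicator (\<Union>i<m. A i) x :: complex) \<partial>M)
            \<longlonglongrightarrow> 0" by simp
      qed (use fin bdd ind in auto)
    qed
  qed
  have "?P h" if "integrable M h" for h
    using that
  proof (induction rule: integrable_induct)
    case (base A c)
    have "(\<integral>x. (indicat_real A x *\<^sub>R c) * u (r n) x \<partial>M) =
        c * (\<integral>x. indicator A x * u (r n) x \<partial>M)" for n
    proof -
      have "(\<integral>x. (indicat_real A x *\<^sub>R c) * u (r n) x \<partial>M) =
          (\<integral>x. c * (indicator A x * u (r n) x) \<partial>M)"
        by (intro Bochner_Integration.integral_cong) (auto split: split_indicator)
      then show ?thesis by (simp only: integral_mult_right_zero)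
    qed
    then show ?case using convergent_mult[OF convergent_const[of c] sets_P[OF base(1)]] by (simp only:)
  next
    case (add f g)
    then show ?case using P_add by blast
  next
    case (lim f s)
    show ?case
    proof (rule convergent_integrals_L1_closed[where k=s and C=C])
      have "(\<lambda>i. \<integral>x. norm (f x - s i x) \<partial>M) \<longlonglongrightarrow> (\<integral>x. 0 \<partial>M)"
      proof (rule integral_dominated_convergence[where w="\<lambda>x. 3 * norm (f x)"])
        show "AE x in M. (\<lambda>i. norm (f x - s i x)) \<longlonglongrightarrow> 0"
        proof (rule AE_I2)
          fix x assume "x \<in> space M"
          then have "(\<lambda>i. s i x) \<longlonglongrightarrow> f x" using lim.hyps by blast
          then have "(\<lambda>i. norm (f x - s i x)) \<longlonglongrightarrow> norm (f x - f x)"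
            by (intro tendsto_intros)
          then show "(\<lambda>i. norm (f x - s i x)) \<longlonglongrightarrow> 0" by simp
        qed
        fix i show "AE x in M. norm (norm (f x - s i x)) \<le> 3 * norm (f x)"
        proof (rule AE_I2)
          fix x assume "x \<in> space M"
          then show "norm (norm (f x - s i x)) \<le> 3 * norm (f x)"
            using lim.hyps(3)[of x i] norm_triangle_ineq4[of "f x" "s i x"] by simp
        qed
      qed (use lim in auto)
      then show "(\<lambda>i. \<integral>x. norm (f x - s i x) \<partial>M) \<longlonglongrightarrow> 0" by simp
    qed (use lim bdd in auto)
  qed
  then show ?thesis using r by blast
qed

text \<open>
  Closure under intersections is included so that Dynkin's theorem applies to \<open>G\<close> directly.
\<close>

definition countably_generated :: "'a measure \<Rightarrow> bool" where
  "countably_generated M \<longleftrightarrow>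
     (\<exists>G. countable G \<and> Int_stable G \<and> G \<subseteq> Pow (space M) \<and> sets M = sigma_sets (space M) G)"

text \<open>
  Sequential weak-* compactness of balls in \<open>L\<^sup>\<infinity>\<close>. A strictly positive integrable weight \<open>e\<close> turns
  the \<open>\<sigma>\<close>-finite measure into a finite one with the same null sets, and \<open>h \<mapsto> h / e\<close> identifies the
  two \<open>L\<^sup>1\<close> spaces.
\<close>

lemma weak_star_subsequence:
  fixes u :: "nat \<Rightarrow> 'a \<Rightarrow> complex"
  assumes "sigma_finite_measure M" and "countably_generated M"
    and [measurable]: "\<And>n. u n \<in> borel_measurable M"
    and bdd: "\<And>n. AE x in M. norm (u n x) \<le> C"
  obtains r where "strict_mono r"
    and "\<And>h. integrable M h \<Longrightarrow> convergent (\<lambda>n. \<integral>x. h x * u (r n) x \<partial>M)"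
proof -
  interpret sigma_finite_measure M by fact
  obtain e :: "'a \<Rightarrow> real" where e [measurable]: "e \<in> borel_measurable M"
    and pos: "\<And>x. e x > 0" and int_e: "integrable M e"
    using obtain_positive_integrable_function by metis
  let ?N = "density M (\<lambda>x. ennreal (e x))"
  have fin: "finite_measure ?N"
  proof
    have "emeasure ?N (space ?N) = (\<integral>\<^sup>+x. ennreal (e x) \<partial>M)"
      by (simp add: emeasure_density cong: nn_integral_cong)
    also have "\<dots> < \<infinity>"
      using int_e pos by (simp add: nn_integral_eq_integral less_imp_le)
    finally show "emeasure ?N (space ?N) \<noteq> \<infinity>" by simp
  qed
  obtain G where G: "countable G" "Int_stable G" "G \<subseteq> Pow (space M)" "sets M = sigma_sets (space M) G"
    using assms(2) unfolding countably_generated_def by auto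
  have bdd': "AE x in ?N. norm (u n x) \<le> C" for n
    using bdd[of n] by (subst AE_density) auto
  obtain r where r: "strict_mono r"
    and conv: "\<And>h. integrable ?N h \<Longrightarrow> convergent (\<lambda>n. \<integral>x. h x * u (r n) x \<partial>?N)"
    using weak_star_subsequence_finite[OF fin G(1,2), of u C] G(3,4) bdd' by auto
  have "convergent (\<lambda>n. \<integral>x. h x * u (r n) x \<partial>M)" if h: "integrable M h" for h
  proof -
    have [measurable]: "h \<in> borel_measurable M" using h by simp
    have ne: "e x \<noteq> 0" for x using pos[of x] by simp
    have "integrable ?N (\<lambda>x. h x / of_real (e x))"
      using h pos by (subst integrable_density) (auto simp: less_imp_le scaleR_conv_of_real ne)
    from conv[OF this] show ?thesis
      using pos by (subst (asm) integral_density) (auto simp: less_imp_le scaleR_conv_of_real ne)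
  qed
  then show ?thesis using r that by blast
qed

text \<open>
  The finite intersections of a countable basis, traced on \<open>S\<close>, generate the trace \<open>\<sigma>\<close>-algebra.
\<close>

lemma countably_generated_restrict_borel:
  assumes sets: "sets M = sets (restrict_space (borel :: 'a::second_countable_topology measure) S)"
    and S: "S \<in> sets borel"
  shows "countably_generated M"
proof -
  obtain B :: "'a set set" where B: "countable B" "topological_basis B"
    using ex_countable_basis by blast
  define I where "I = {\<Inter>F | F. finite F \<and> F \<subseteq> B}"
  have "I = Inter ` {F. finite F \<and> F \<subseteq> B}" unfolding I_def by auto
  then have cI: "countable I" using B(1) by (simp add: countable_Collect_finite_subset)
  have stable: "a \<inter> b \<in> I" if "a \<in> I" "b \<in> I" for a b
  proof -
    from that obtain F F' where "a = \<Inter>F" "b = \<Inter>F'" "finite F" "F \<subseteq> B" "finite F'" "F' \<subseteq> B"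
      unfolding I_def by auto
    then have "a \<inter> b = \<Inter>(F \<union> F')" "finite (F \<union> F')" "F \<union> F' \<subseteq> B" by auto
    then show ?thesis unfolding I_def by blast
  qed
  have "B \<subseteq> I"
  proof
    fix b assume "b \<in> B"
    then have "b = \<Inter>{b}" "finite {b}" "{b} \<subseteq> B" by auto
    then show "b \<in> I" unfolding I_def by blast
  qed
  have bor: "sets (borel :: 'a measure) = sigma_sets UNIV I"
  proof (rule antisym)
    show "sets borel \<subseteq> sigma_sets UNIV I"
      unfolding borel_eq_countable_basis[OF B]
      using \<open>B \<subseteq> I\<close> by (simp add: sigma_sets_mono')
    have "I \<subseteq> sets borel"
      unfolding I_def using B(2)
      by (auto intro!: borel_open open_Inter dest: topological_basis_open)
    then show "sigma_sets UNIV I \<subseteq> sets (borel :: 'a measure)"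
      using sets.sigma_sets_subset[of I "borel :: 'a measure"] by simp
  qed
  have sp: "space M = S"
    using sets_eq_imp_space_eq[OF sets] by (simp add: space_restrict_space)
  have "sets M = sigma_sets S ((\<inter>) S ` I)"
    unfolding sets sets_restrict_space bor
    using S bor by (intro sigma_sets_Int) auto
  then show ?thesis unfolding countably_generated_def sp
    by (intro exI[of _ "(\<inter>) S ` I"]) (auto simp: Int_stable_def cI intro!: stable)
qed

section \<open>Exponents, pairings and Jensen's inequality\<close>

text \<open>
  Extended exponents are only ever used through these three cases; the conventions \<open>1 / \<infinity> = 0\<close> and
  \<open>1 / 0 = \<infinity>\<close> exclude all others.
\<close>

lemma conjugate_exponent_cases:
  fixes p q :: ennreal
  assumes "1 \<le> p" "1 / p + 1 / q = 1"
  obtains (top) "p = \<infinity>" "q = 1"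
    | (one) "p = 1" "q = \<infinity>"
    | (mid) p' q' where "p = ennreal p'" "q = ennreal q'" "1 < p'" "1 < q'" "1 / p' + 1 / q' = 1"
proof (cases "p = \<infinity>")
  case True
  then have "1 / q = 1" using assms(2) by (simp add: divide_ennreal_def)
  then have "q = 1"
  proof (cases q)
    case (real b)
    with \<open>1 / q = 1\<close> have "b \<noteq> 0" by (auto simp: divide_ennreal_def)
    with real \<open>1 / q = 1\<close> have "ennreal (1 / b) = ennreal 1"
      by (simp add: divide_ennreal flip: ennreal_1)
    then show ?thesis using real \<open>b \<noteq> 0\<close> by (simp add: field_simps)
  qed (simp add: divide_ennreal_def)
  then show ?thesis using True top by blast
next
  case False
  then obtain a where a: "p = ennreal a" "0 \<le> a" by (cases p) auto
  with assms(1) have a1: "1 \<le> a" by (simp flip: ennreal_1)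
  show ?thesis
  proof (cases "q = \<infinity>")
    case True
    then have "1 / p = 1" using assms(2) by (simp add: divide_ennreal_def)
    then have "ennreal (1 / a) = ennreal 1"
      using a a1 by (simp add: divide_ennreal flip: ennreal_1)
    then have "a = 1" using a1 by simp
    then show ?thesis using True one a by simp
  next
    case False
    then obtain b where b: "q = ennreal b" "0 \<le> b" by (cases q) auto
    have "b \<noteq> 0"
    proof
      assume "b = 0"
      then have "1 / q = \<infinity>" using b by (simp add: divide_ennreal_def)
      then show False using assms(2) by simp
    qed
    then have "0 < b" using b by simp
    have "ennreal (1 / a + 1 / b) = ennreal 1"
      using assms(2) a b a1 \<open>0 < b\<close> by (simp add: divide_ennreal flip: ennreal_1 ennreal_plus)
    then have eq: "1 / a + 1 / b = 1" using a1 \<open>0 < b\<close> by (subst (asm) ennreal_inj) auto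
    moreover have "0 < 1 / a" "0 < 1 / b" using a1 \<open>0 < b\<close> by simp_all
    ultimately have "1 / a < 1" "1 / b < 1" by linarith+
    then have "1 < a" "1 < b" using a1 \<open>0 < b\<close> by (simp_all add: divide_less_eq)
    then show ?thesis using mid[OF a(1) b(1) _ _ eq] by simp
  qed
qed

text \<open>
  A bound that can be stated uniformly over a family of functions. For finite \<open>p\<close> the constant bounds
  the \<open>p\<close>-th power of the norm, which avoids taking roots.
\<close>

definition Lp_bounded :: "'a measure \<Rightarrow> ennreal \<Rightarrow> real \<Rightarrow> ('a \<Rightarrow> complex) \<Rightarrow> bool" where
  "Lp_bounded M p C f \<longleftrightarrow> f \<in> borel_measurable M \<and>
     (if p = \<infinity> then AE x in M. norm (f x) \<le> C
      else (\<integral>\<^sup>+x. ennreal (norm (f x) powr enn2real p) \<partial>M) \<le> ennreal C)"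

lemma Lp_bounded_imp_Lp_space:
  assumes "Lp_bounded M p C f" shows "f \<in> Lp_space M p"
proof -
  have [measurable]: "f \<in> borel_measurable M" using assms by (simp add: Lp_bounded_def)
  show ?thesis
  proof (cases "p = \<infinity>")
    case True
    then have "AE x in M. norm (f x) \<le> C" using assms by (simp add: Lp_bounded_def)
    then have "AE x in M. ennreal (norm (f x)) \<le> ennreal C"
      by eventually_elim (simp add: ennreal_leI)
    then have "esssup M (\<lambda>x. ennreal (norm (f x))) \<le> ennreal C" by (intro esssup_I) auto
    also have "\<dots> < \<infinity>" by simp
    finally show ?thesis using True by (simp add: Lp_space_def)
  next
    case False
    then have "(\<integral>\<^sup>+x. ennreal (norm (f x) powr enn2real p) \<partial>M) \<le> ennreal C"
      using assms by (simp add: Lp_bounded_def)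
    also have "\<dots> < \<infinity>" by simp
    finally have "integrable M (\<lambda>x. norm (f x) powr enn2real p)" by (simp add: integrable_iff_bounded)
    then show ?thesis using False by (simp add: Lp_space_def)
  qed
qed

lemma Lp_space_imp_Lp_bounded:
  assumes p: "1 \<le> p" and f: "f \<in> Lp_space M p" and C: "Lp_norm M p f \<le> C"
  shows "Lp_bounded M p (if p = \<infinity> then C else C powr enn2real p) f"
proof (cases "p = \<infinity>")
  case True
  have [measurable]: "f \<in> borel_measurable M" using f by (simp add: Lp_space_def)
  have fin: "esssup M (\<lambda>x. ennreal (norm (f x))) < \<infinity>" using f True by (simp add: Lp_space_def)
  have "AE x in M. ennreal (norm (f x)) \<le> esssup M (\<lambda>x. ennreal (norm (f x)))" by (rule esssup_AE)
  then have "AE x in M. norm (f x) \<le> C"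
  proof eventually_elim
    case (elim x)
    then have "enn2real (ennreal (norm (f x))) \<le> enn2real (esssup M (\<lambda>x. ennreal (norm (f x))))"
      using fin by (intro enn2real_mono) auto
    then show ?case using C True by (simp add: Lp_norm_def)
  qed
  then show ?thesis using True by (simp add: Lp_bounded_def)
next
  case False
  then obtain a where a: "p = ennreal a" "0 \<le> a" by (cases p) auto
  with p have a1: "1 \<le> a" by (simp flip: ennreal_1)
  let ?I = "LINT x|M. norm (f x) powr a"
  have int: "integrable M (\<lambda>x. norm (f x) powr a)" and m [measurable]: "f \<in> borel_measurable M"
    using f a False by (auto simp: Lp_space_def)
  have I0: "0 \<le> ?I" by simp
  have "?I powr (1 / a) \<le> C" using C a False by (simp add: Lp_norm_def)
  then have "(?I powr (1 / a)) powr a \<le> C powr a" using a1 by (intro powr_mono2) auto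
  then have "?I \<le> C powr a" using a1 I0 by (simp add: powr_powr)
  then have "(\<integral>\<^sup>+x. ennreal (norm (f x) powr a) \<partial>M) \<le> ennreal (C powr a)"
    using int by (subst nn_integral_eq_integral) (auto intro: ennreal_leI)
  then show ?thesis using a False by (simp add: Lp_bounded_def)
qed

lemma Lp_space_dominated:
  assumes "E \<in> Lp_space M p" "f \<in> borel_measurable M" "0 \<le> K"
    and "AE y in M. norm (f y) \<le> K * norm (E y)"
  shows "f \<in> Lp_space M p"
proof -
  note [measurable] = assms(2)
  have [measurable]: "E \<in> borel_measurable M" using assms(1) by (simp add: Lp_space_def)
  show ?thesis
  proof (cases "p = \<infinity>")
    case True
    have fin: "esssup M (\<lambda>x. ennreal (norm (E x))) < \<infinity>"
      using assms(1) True by (simp add: Lp_space_def)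
    have "AE x in M. ennreal (norm (E x)) \<le> esssup M (\<lambda>x. ennreal (norm (E x)))" by (rule esssup_AE)
    with assms(4) have "AE x in M. norm (f x) \<le> K * enn2real (esssup M (\<lambda>x. ennreal (norm (E x))))"
    proof eventually_elim
      case (elim x)
      then have "enn2real (ennreal (norm (E x))) \<le> enn2real (esssup M (\<lambda>x. ennreal (norm (E x))))"
        using fin by (intro enn2real_mono) auto
      then have "K * norm (E x) \<le> K * enn2real (esssup M (\<lambda>x. ennreal (norm (E x))))"
        using assms(3) by (intro mult_left_mono) auto
      then show ?case using elim by simp
    qed
    then have "Lp_bounded M p (K * enn2real (esssup M (\<lambda>x. ennreal (norm (E x))))) f"
      using True by (simp add: Lp_bounded_def)
    then show ?thesis by (rule Lp_bounded_imp_Lp_space)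
  next
    case False
    have "integrable M (\<lambda>x. K powr enn2real p * norm (E x) powr enn2real p)"
      using assms(1) False by (simp add: Lp_space_def)
    then have "integrable M (\<lambda>x. norm (f x) powr enn2real p)"
    proof (rule Bochner_Integration.integrable_bound)
      show "AE x in M. norm (norm (f x) powr enn2real p) \<le>
          norm (K powr enn2real p * norm (E x) powr enn2real p)"
        using assms(4)
      proof eventually_elim
        case (elim x)
        then have "norm (f x) powr enn2real p \<le> (K * norm (E x)) powr enn2real p"
          by (intro powr_mono2) auto
        then show ?case using assms(3) by (simp add: powr_mult)
      qed
    qed simp
    then show ?thesis using False by (simp add: Lp_space_def)
  qed
qed

text \<open>
  A substitute for Hoelder's inequality. Compactness asks for the pairing to be bounded on bounded
  sets, and this much follows for \<open>1 < p < \<infinity>\<close> by integrating Young's pointwise inequality. The bound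
  is chosen so as to cover the two endpoint cases as well.
\<close>

lemma Lp_bounded_pairing:
  assumes pq: "1 \<le> p" "1 / p + 1 / q = 1"
    and f: "Lp_bounded M p A f" and g: "Lp_bounded M q B g"
  shows "integrable M (\<lambda>x. f x * g x)"
    and "norm (\<integral>x. f x * g x \<partial>M) \<le> \<bar>A\<bar> * \<bar>B\<bar> + \<bar>A\<bar> + \<bar>B\<bar>"
proof -
  have meas [measurable]: "f \<in> borel_measurable M" "g \<in> borel_measurable M"
    using f g by (auto simp: Lp_bounded_def)
  have L1: "integrable M h \<and> (\<integral>x. norm (h x) \<partial>M) \<le> \<bar>D\<bar>"
    if h: "Lp_bounded M 1 D h" for h D
  proof -
    have [measurable]: "h \<in> borel_measurable M" using h by (simp add: Lp_bounded_def)
    have le: "(\<integral>\<^sup>+x. ennreal (norm (h x)) \<partial>M) \<le> ennreal D" using h by (simp add: Lp_bounded_def)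
    also have "\<dots> < \<infinity>" by simp
    finally have int: "integrable M h" by (simp add: integrable_iff_bounded)
    have "ennreal (\<integral>x. norm (h x) \<partial>M) \<le> ennreal D"
      using le int by (subst (asm) nn_integral_eq_integral) auto
    also have "\<dots> \<le> ennreal \<bar>D\<bar>" by (intro ennreal_leI) simp
    finally show ?thesis using int by simp
  qed
  have sup_case: "integrable M (\<lambda>x. h x * k x) \<and> norm (\<integral>x. h x * k x \<partial>M) \<le> \<bar>D\<bar> * \<bar>F\<bar>"
    if h: "Lp_bounded M 1 D h" and k: "Lp_bounded M \<infinity> F k" for h k D F
  proof -
    have [measurable]: "k \<in> borel_measurable M" and "AE x in M. norm (k x) \<le> F"
      using k by (auto simp: Lp_bounded_def)
    then have ae: "AE x in M. norm (k x) \<le> \<bar>F\<bar>" by (auto elim: eventually_mono)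
    have "norm (\<integral>x. h x * k x \<partial>M) \<le> \<bar>F\<bar> * (\<integral>x. norm (h x) \<partial>M)"
      using integrable_mult_AE_bounded(2)[OF _ _ ae] L1[OF h] by simp
    also have "\<dots> \<le> \<bar>F\<bar> * \<bar>D\<bar>" using L1[OF h] by (intro mult_left_mono) auto
    finally show ?thesis
      using integrable_mult_AE_bounded(1)[OF _ _ ae] L1[OF h] by (simp add: mult.commute)
  qed
  have "integrable M (\<lambda>x. f x * g x) \<and> norm (\<integral>x. f x * g x \<partial>M) \<le> \<bar>A\<bar> * \<bar>B\<bar> + \<bar>A\<bar> + \<bar>B\<bar>"
    using pq
  proof (cases rule: conjugate_exponent_cases)
    case top
    then show ?thesis using sup_case[of B g A f] f g by (simp add: mult.commute add_increasing2)
  next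
    case one
    then show ?thesis using sup_case[of A f B g] f g by (simp add: add_increasing2)
  next
    case (mid p' q')
    let ?h = "\<lambda>x. norm (f x) powr p' + norm (g x) powr q'"
    have nf: "(\<integral>\<^sup>+x. ennreal (norm (f x) powr p') \<partial>M) \<le> ennreal \<bar>A\<bar>"
      and ng: "(\<integral>\<^sup>+x. ennreal (norm (g x) powr q') \<partial>M) \<le> ennreal \<bar>B\<bar>"
      using f g mid by (auto simp: Lp_bounded_def intro: order_trans[OF _ ennreal_leI])
    have nh: "(\<integral>\<^sup>+x. ennreal (?h x) \<partial>M) \<le> ennreal (\<bar>A\<bar> + \<bar>B\<bar>)"
      using add_mono[OF nf ng] by (simp add: nn_integral_add)
    have le: "norm (f x * g x) \<le> ?h x" for x
    proof -
      have "norm (f x) * norm (g x) \<le> norm (f x) powr p' / p' + norm (g x) powr q' / q'"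
        using mid by (intro Youngs_inequality) auto
      also have "\<dots> \<le> ?h x"
        using mid mult_left_mono[of 1 p' "norm (f x) powr p'"] mult_left_mono[of 1 q' "norm (g x) powr q'"]
        by (intro add_mono) (auto simp: divide_le_eq)
      finally show ?thesis by (simp add: norm_mult)
    qed
    have nfg: "(\<integral>\<^sup>+x. ennreal (norm (f x * g x)) \<partial>M) \<le> ennreal (\<bar>A\<bar> + \<bar>B\<bar>)"
      by (rule order_trans[OF nn_integral_mono nh]) (intro ennreal_leI le)
    then have int: "integrable M (\<lambda>x. f x * g x)"
      by (auto simp: integrable_iff_bounded intro: le_less_trans)
    have "ennreal (norm (\<integral>x. f x * g x \<partial>M)) \<le> ennreal (\<bar>A\<bar> + \<bar>B\<bar>)"
      using integral_norm_bound_ennreal[OF int] nfg by (rule order_trans)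
    then have "norm (\<integral>x. f x * g x \<partial>M) \<le> \<bar>A\<bar> + \<bar>B\<bar>"
      by (subst (asm) ennreal_le_iff) auto
    moreover have "0 \<le> \<bar>A\<bar> * \<bar>B\<bar>" by simp
    ultimately show ?thesis by (intro conjI int) linarith
  qed
  then show "integrable M (\<lambda>x. f x * g x)"
    and "norm (\<integral>x. f x * g x \<partial>M) \<le> \<bar>A\<bar> * \<bar>B\<bar> + \<bar>A\<bar> + \<bar>B\<bar>" by auto
qed

lemma le_one_plus_powr: "(x::real) \<le> 1 + x powr a" if "0 \<le> x" "1 \<le> a"
proof (cases "x \<le> 1")
  case False
  then have "x powr 1 \<le> x powr a" using that by (intro powr_mono) auto
  then show ?thesis using False by simp
qed (simp add: add_increasing2)

lemma integrable_of_powr_integrable: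
  fixes f :: "'a \<Rightarrow> complex"
  assumes "finite_measure M" "1 \<le> a" and [measurable]: "f \<in> borel_measurable M"
    and int: "integrable M (\<lambda>x. norm (f x) powr a)"
  shows "integrable M f"
proof -
  interpret finite_measure M by fact
  have "integrable M (\<lambda>x. 1 + norm (f x) powr a)" using int by simp
  then show ?thesis
    by (rule Bochner_Integration.integrable_bound)
      (use le_one_plus_powr[OF norm_ge_zero \<open>1 \<le> a\<close>] in auto)
qed

text \<open>
  Jensen's inequality for \<open>t \<mapsto> t\<^sup>a\<close> on a finite measure of total mass \<open>m\<close>, in a form that remains
  true when the right-hand side is infinite. The supporting line of the power at the mean
  \<open>c = (\<integral> |f|) / m\<close> is itself an instance of Young's inequality.
\<close>

lemma norm_integral_powr_le:
  fixes f :: "'a \<Rightarrow> complex"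
  assumes "finite_measure M" and a: "1 \<le> a" and [measurable]: "f \<in> borel_measurable M"
  shows "ennreal (norm (\<integral>x. f x \<partial>M) powr a) \<le>
    ennreal (measure M (space M) powr (a - 1)) * (\<integral>\<^sup>+x. ennreal (norm (f x) powr a) \<partial>M)"
proof -
  interpret finite_measure M by fact
  define m where "m = measure M (space M)"
  consider "m = 0" | "m > 0" "(\<integral>\<^sup>+x. ennreal (norm (f x) powr a) \<partial>M) = \<infinity>"
    | "m > 0" "(\<integral>\<^sup>+x. ennreal (norm (f x) powr a) \<partial>M) < \<infinity>"
    unfolding m_def by (metis less_eq_real_def measure_nonneg top.not_eq_extremum infinity_ennreal_def)
  then show ?thesis
  proof cases
    case 1
    then have "emeasure M (space M) = 0" by (simp add: m_def emeasure_eq_measure)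
    then have "AE x in M. f x = 0" by (intro AE_I[of _ _ "space M"]) auto
    then have "(\<integral>x. f x \<partial>M) = 0" using integral_eq_zero_AE by blast
    then show ?thesis by simp
  next
    case 2
    then show ?thesis by (simp add: m_def ennreal_mult_top)
  next
    case 3
    then have int: "integrable M (\<lambda>x. norm (f x) powr a)" by (simp add: integrable_iff_bounded)
    have intf: "integrable M f" by (rule integrable_of_powr_integrable[OF assms(1) a _ int]) simp
    define I where "I = (\<integral>x. norm (f x) \<partial>M)"
    define c where "c = I / m"
    have I0: "0 \<le> I" by (simp add: I_def)
    have c0: "0 \<le> c" using I0 3 by (simp add: c_def)
    have tangent: "a * c powr (a - 1) * t \<le> t powr a + (a - 1) * c powr a" if "0 \<le> t" for t
    proof (cases "a = 1")
      case True
      then show ?thesis using that by (cases "c = 0") auto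
    next
      case False
      with a have a1: "1 < a" by simp
      \<comment> \<open>The conjugate exponent of \<open>a\<close>: then \<open>(c powr (a - 1)) powr b = c powr a\<close>.\<close>
      define b where "b = a / (a - 1)"
      have "t * c powr (a - 1) \<le> t powr a / a + (c powr (a - 1)) powr b / b"
        by (rule Youngs_inequality) (use a1 that in \<open>auto simp: b_def field_simps\<close>)
      also have "(c powr (a - 1)) powr b = c powr a"
        using a1 by (simp add: powr_powr b_def)
      finally have "a * (t * c powr (a - 1)) \<le> a * (t powr a / a + c powr a / b)"
        using a1 by (intro mult_left_mono) auto
      also have "\<dots> = t powr a + (a - 1) * c powr a"
        using a1 by (simp add: b_def field_simps)
      finally show ?thesis by (simp add: mult_ac)
    qed
    have "(\<integral>x. a * c powr (a - 1) * norm (f x) \<partial>M) \<le> (\<integral>x. norm (f x) powr a + (a - 1) * c powr a \<partial>M)"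
      by (rule integral_mono) (use int intf tangent in auto)
    then have "a * c powr (a - 1) * I \<le> (\<integral>x. norm (f x) powr a \<partial>M) + m * ((a - 1) * c powr a)"
      using int by (simp add: I_def m_def)
    moreover have "c powr (a - 1) * I = m * c powr a"
    proof (cases "c = 0")
      case False
      then have "c powr a = c powr (a - 1) * c" using c0 powr_mult_base[of c "a - 1"] by (simp add: mult.commute)
      then show ?thesis using 3 by (simp add: c_def)
    qed simp
    ultimately have "a * (m * c powr a) \<le> (\<integral>x. norm (f x) powr a \<partial>M) + m * ((a - 1) * c powr a)"
      by (simp add: mult.assoc)
    then have "m * c powr a \<le> (\<integral>x. norm (f x) powr a \<partial>M)" by (simp add: algebra_simps)
    then have "m powr (a - 1) * (m * c powr a) \<le> m powr (a - 1) * (\<integral>x. norm (f x) powr a \<partial>M)"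
      by (intro mult_left_mono) auto
    moreover have "m powr (a - 1) * (m * c powr a) = I powr a"
    proof -
      have "m powr (a - 1) * (m * c powr a) = m powr a * c powr a"
        using 3 powr_mult_base[of m "a - 1"] by (simp add: mult_ac)
      also have "\<dots> = I powr a" using 3 I0 c0 by (simp add: c_def flip: powr_mult)
      finally show ?thesis .
    qed
    moreover have "norm (\<integral>x. f x \<partial>M) powr a \<le> I powr a"
      using a by (intro powr_mono2) (auto simp: I_def)
    ultimately have "ennreal (norm (\<integral>x. f x \<partial>M) powr a) \<le> ennreal (m powr (a - 1) * (\<integral>x. norm (f x) powr a \<partial>M))"
      by (intro ennreal_leI) simp
    then show ?thesis
      using int by (subst nn_integral_eq_integral) (auto simp: m_def ennreal_mult)
  qed
qed

section \<open>Superpositions of rank-one operators\<close>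

text \<open>
  The setting of an operator \<open>f \<mapsto> \<integral> s(\<xi>) \<langle>f, P\<^sub>\<xi>\<rangle> Q\<^sub>\<xi> d\<xi>\<close>, an integral of rank-one operators whose norms
  are uniformly bounded, against an integrable \<open>s\<close>. Measurability is required jointly in
  \<open>(\<xi>, y)\<close> rather than of \<open>\<xi> \<mapsto> Q\<^sub>\<xi>\<close> as a map into \<open>L\<^sup>p\<close>: for \<open>p = \<infinity>\<close> translates of a fixed function
  are in general not strongly measurable, and the operator need not be a Bochner integral.
\<close>

locale kernel_family = M: sigma_finite_measure M + N: sigma_finite_measure N
  for M :: "'a measure" and N :: "'b measure" +
  fixes p q :: ennreal and s :: "'b \<Rightarrow> complex" and P Q :: "'b \<Rightarrow> 'a \<Rightarrow> complex" and A B :: real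
  assumes p: "1 \<le> p" and pq: "1 / p + 1 / q = 1"
    and gen_M: "countably_generated M" and gen_N: "countably_generated N"
    and s: "integrable N s"
    and P_measurable [measurable]: "(\<lambda>(\<xi>, y). P \<xi> y) \<in> borel_measurable (N \<Otimes>\<^sub>M M)"
    and Q_measurable [measurable]: "(\<lambda>(\<xi>, y). Q \<xi> y) \<in> borel_measurable (N \<Otimes>\<^sub>M M)"
    and P_bounded: "\<And>\<xi>. \<xi> \<in> space N \<Longrightarrow> Lp_bounded M q A (P \<xi>)"
    and Q_bounded: "\<And>\<xi>. \<xi> \<in> space N \<Longrightarrow> Lp_bounded M p B (Q \<xi>)"
begin

sublocale NM: pair_sigma_finite N M ..

lemma s_measurable [measurable]: "s \<in> borel_measurable N" using s by simp

definition coeff :: "('a \<Rightarrow> complex) \<Rightarrow> 'b \<Rightarrow> complex" where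
  "coeff f \<xi> = (\<integral>z. f z * P \<xi> z \<partial>M)"

definition superposition :: "('a \<Rightarrow> complex) \<Rightarrow> 'a \<Rightarrow> complex" where
  "superposition f y = (\<integral>\<xi>. s \<xi> * coeff f \<xi> * Q \<xi> y \<partial>N)"

text \<open>
  The common majorant: almost everywhere \<open>|superposition f| \<le> K * envelope\<close> whenever \<open>K\<close> bounds the coefficients of \<open>f\<close>.
\<close>

definition envelope :: "'a \<Rightarrow> real" where
  "envelope y = (\<integral>\<xi>. norm (s \<xi> * Q \<xi> y) \<partial>N)"

lemma coeff_measurable [measurable]:
  assumes [measurable]: "f \<in> borel_measurable M"
  shows "coeff f \<in> borel_measurable N"
  unfolding coeff_def[abs_def] by measurable

lemma superposition_measurable [measurable]:
  assumes [measurable]: "f \<in> borel_measurable M"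
  shows "superposition f \<in> borel_measurable M"
  unfolding superposition_def[abs_def] by measurable

lemma envelope_measurable [measurable]: "envelope \<in> borel_measurable M"
  unfolding envelope_def[abs_def] by measurable

lemma envelope_nonneg: "0 \<le> envelope y"
  by (simp add: envelope_def)

lemma coeff_integrable:
  assumes "Lp_bounded M p C f" "\<xi> \<in> space N"
  shows "integrable M (\<lambda>z. f z * P \<xi> z)"
  using Lp_bounded_pairing(1)[OF p pq assms(1) P_bounded[OF assms(2)]] .

lemma coeff_bounded:
  assumes "Lp_bounded M p C f" "\<xi> \<in> space N"
  shows "norm (coeff f \<xi>) \<le> \<bar>C\<bar> * \<bar>A\<bar> + \<bar>C\<bar> + \<bar>A\<bar>"
  unfolding coeff_def using Lp_bounded_pairing(2)[OF p pq assms(1) P_bounded[OF assms(2)]] .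

lemma AE_Q_bounded:
  assumes "p = \<infinity>"
  shows "AE y in M. AE \<xi> in N. norm (Q \<xi> y) \<le> B"
proof -
  have "AE \<xi> in N. AE y in M. norm (Q \<xi> y) \<le> B"
  proof (rule AE_I2)
    fix \<xi> assume "\<xi> \<in> space N"
    then show "AE y in M. norm (Q \<xi> y) \<le> B"
      using Q_bounded assms by (simp add: Lp_bounded_def)
  qed
  moreover have "{x \<in> space (N \<Otimes>\<^sub>M M). norm (Q (fst x) (snd x)) \<le> B} \<in> sets (N \<Otimes>\<^sub>M M)"
    by measurable
  ultimately show ?thesis using NM.AE_commute[of "\<lambda>\<xi> y. norm (Q \<xi> y) \<le> B"] by simp
qed

text \<open>
  The majorant lies in \<open>L\<^sup>p\<close>. For \<open>p < \<infinity>\<close> this is Minkowski's integral inequality, obtained from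
  Jensen's inequality for the finite measure \<open>|s| d\<xi>\<close> and Tonelli. For \<open>p = \<infinity>\<close> the bound on each
  \<open>Q\<^sub>\<xi>\<close> outside a null set of \<open>y\<close> is turned, by Fubini, into a bound for almost every \<open>y\<close> and almost
  every \<open>\<xi>\<close>.
\<close>

lemma envelope_Lp:
  shows "(\<lambda>y. of_real (envelope y)) \<in> Lp_space M p"
    and "AE y in M. integrable N (\<lambda>\<xi>. s \<xi> * Q \<xi> y)"
proof -
  have "(\<lambda>y. of_real (envelope y)) \<in> Lp_space M p \<and> (AE y in M. integrable N (\<lambda>\<xi>. s \<xi> * Q \<xi> y))"
  proof (cases "p = \<infinity>")
    case True
    have est: "integrable N (\<lambda>\<xi>. s \<xi> * Q \<xi> y) \<and> envelope y \<le> B * (\<integral>\<xi>. norm (s \<xi>) \<partial>N)"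
      if y: "y \<in> space M" and ae: "AE \<xi> in N. norm (Q \<xi> y) \<le> B" for y
    proof -
      have [measurable]: "(\<lambda>\<xi>. Q \<xi> y) \<in> borel_measurable N" using y by measurable
      have int: "integrable N (\<lambda>\<xi>. s \<xi> * Q \<xi> y)"
        by (rule integrable_mult_AE_bounded(1)[OF s _ ae]) measurable
      have "envelope y \<le> (\<integral>\<xi>. B * norm (s \<xi>) \<partial>N)"
        unfolding envelope_def
      proof (rule integral_mono_AE)
        show "AE \<xi> in N. norm (s \<xi> * Q \<xi> y) \<le> B * norm (s \<xi>)"
          using ae by eventually_elim (simp add: norm_mult mult.commute[of B] mult_left_mono)
      qed (use int s in auto)
      then show ?thesis using int by simp
    qed
    have "AE y in M. integrable N (\<lambda>\<xi>. s \<xi> * Q \<xi> y) \<and> envelope y \<le> B * (\<integral>\<xi>. norm (s \<xi>) \<partial>N)"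
      using AE_Q_bounded[OF True] AE_space by eventually_elim (use est in blast)
    then have "AE y in M. integrable N (\<lambda>\<xi>. s \<xi> * Q \<xi> y)"
      and le: "AE y in M. envelope y \<le> B * (\<integral>\<xi>. norm (s \<xi>) \<partial>N)" by auto
    moreover have "Lp_bounded M p (B * (\<integral>\<xi>. norm (s \<xi>) \<partial>N)) (\<lambda>y. of_real (envelope y))"
      using le True by (simp add: Lp_bounded_def envelope_nonneg)
    ultimately show ?thesis using Lp_bounded_imp_Lp_space by blast
  next
    case False
    then obtain a where a: "p = ennreal a" "0 \<le> a" by (cases p) auto
    with p have a1: "1 \<le> a" by (simp flip: ennreal_1)
    define V where "V = density N (\<lambda>\<xi>. ennreal (norm (s \<xi>)))"
    have sV [measurable_cong]: "sets V = sets N" by (simp add: V_def)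
    have "emeasure V (space V) = (\<integral>\<^sup>+\<xi>. ennreal (norm (s \<xi>)) \<partial>N)"
      unfolding V_def by (simp add: emeasure_density cong: nn_integral_cong)
    also have "\<dots> < \<infinity>" using s by (simp add: integrable_iff_bounded)
    finally have Vfin: "emeasure V (space V) < \<infinity>" .
    then have fin: "finite_measure V" by (intro finite_measureI) auto
    then interpret V: finite_measure V .
    interpret VM: pair_sigma_finite V M ..
    let ?H = "\<lambda>y. \<integral>\<^sup>+\<xi>. ennreal (norm (Q \<xi> y) powr a) \<partial>V"
    have "(\<integral>\<^sup>+y. ?H y \<partial>M) = (\<integral>\<^sup>+\<xi>. (\<integral>\<^sup>+y. ennreal (norm (Q \<xi> y) powr a) \<partial>M) \<partial>V)"
      by (rule VM.Fubini') measurable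
    also have "\<dots> \<le> (\<integral>\<^sup>+\<xi>. ennreal B \<partial>V)"
    proof (rule nn_integral_mono)
      fix \<xi> assume "\<xi> \<in> space V"
      then have "Lp_bounded M p B (Q \<xi>)" using Q_bounded sets_eq_imp_space_eq[OF sV] by auto
      then show "(\<integral>\<^sup>+y. ennreal (norm (Q \<xi> y) powr a) \<partial>M) \<le> ennreal B"
        using a by (simp add: Lp_bounded_def)
    qed
    also have "\<dots> < \<infinity>" using Vfin by (simp add: ennreal_mult_less_top)
    finally have H: "(\<integral>\<^sup>+y. ?H y \<partial>M) < \<infinity>" .
    have "AE y in M. ?H y \<noteq> \<infinity>"
      by (rule nn_integral_PInf_AE) (use H in auto)
    then have int: "AE y in M. integrable N (\<lambda>\<xi>. s \<xi> * Q \<xi> y)"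
      using AE_space
    proof eventually_elim
      case (elim y)
      have [measurable]: "(\<lambda>\<xi>. Q \<xi> y) \<in> borel_measurable N" using elim(2) by measurable
      have "integrable V (\<lambda>\<xi>. norm (Q \<xi> y) powr a)"
        using elim by (simp add: integrable_iff_bounded top.not_eq_extremum)
      then have "integrable V (\<lambda>\<xi>. Q \<xi> y)"
        by (rule integrable_of_powr_integrable[OF fin a1, rotated]) measurable
      then have "integrable N (\<lambda>\<xi>. norm (s \<xi>) *\<^sub>R Q \<xi> y)"
        unfolding V_def by (subst (asm) integrable_density) auto
      then show ?case
        by (rule Bochner_Integration.integrable_bound) (auto simp: norm_mult)
    qed
    let ?m = "ennreal (measure V (space V) powr (a - 1))"
    have env: "ennreal (envelope y powr a) \<le> ?m * ?H y" if y: "y \<in> space M" for y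
    proof -
      have [measurable]: "(\<lambda>\<xi>. Q \<xi> y) \<in> borel_measurable N" using y by measurable
      have "envelope y = (\<integral>\<xi>. norm (Q \<xi> y) \<partial>V)"
        unfolding envelope_def V_def by (subst integral_density) (auto simp: norm_mult)
      then have "norm (\<integral>\<xi>. (of_real (norm (Q \<xi> y)) :: complex) \<partial>V) = envelope y"
        using envelope_nonneg[of y] by simp
      then show ?thesis
        using norm_integral_powr_le[OF fin a1, of "\<lambda>\<xi>. of_real (norm (Q \<xi> y))"]
        by (simp add: abs_of_nonneg[OF envelope_nonneg])
    qed
    have "(\<integral>\<^sup>+y. ennreal (envelope y powr a) \<partial>M) \<le> (\<integral>\<^sup>+y. ?m * ?H y \<partial>M)"
      by (rule nn_integral_mono) (rule env)
    also have "\<dots> = ?m * (\<integral>\<^sup>+y. ?H y \<partial>M)" by (rule nn_integral_cmult) measurable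
    also have "\<dots> < \<infinity>" using H by (simp add: ennreal_mult_less_top)
    finally have "integrable M (\<lambda>y. envelope y powr a)"
      by (simp add: integrable_iff_bounded)
    then have "(\<lambda>y. of_real (envelope y)) \<in> Lp_space M p"
      using a False envelope_nonneg by (simp add: Lp_space_def)
    then show ?thesis using int by blast
  qed
  then show "(\<lambda>y. of_real (envelope y)) \<in> Lp_space M p"
    and "AE y in M. integrable N (\<lambda>\<xi>. s \<xi> * Q \<xi> y)" by auto
qed

lemma superposition_at:
  assumes f: "f \<in> borel_measurable M" and y: "y \<in> space M"
    and int: "integrable N (\<lambda>\<xi>. s \<xi> * Q \<xi> y)"
    and K: "\<And>\<xi>. \<xi> \<in> space N \<Longrightarrow> norm (coeff f \<xi>) \<le> K"
  shows "integrable N (\<lambda>\<xi>. s \<xi> * coeff f \<xi> * Q \<xi> y)"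
    and "norm (superposition f y) \<le> K * envelope y"
proof -
  note [measurable] = f
  have ae: "AE \<xi> in N. norm (coeff f \<xi>) \<le> K" using K by simp
  show "integrable N (\<lambda>\<xi>. s \<xi> * coeff f \<xi> * Q \<xi> y)"
    using integrable_mult_AE_bounded(1)[OF int _ ae] by (simp add: mult_ac)
  show "norm (superposition f y) \<le> K * envelope y"
    using integrable_mult_AE_bounded(2)[OF int _ ae]
    by (simp add: mult_ac superposition_def envelope_def)
qed

lemma superposition_linear: "linear_operator_Lp M p superposition"
  unfolding linear_operator_Lp_def
proof (intro conjI ballI allI impI)
  have bdd: "\<exists>C. Lp_bounded M p C f" if "f \<in> Lp_space M p" for f
    using Lp_space_imp_Lp_bounded[OF p that order_refl] by blast
  have meas: "f \<in> borel_measurable M" if "f \<in> Lp_space M p" for f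
    using that by (simp add: Lp_space_def)
  fix f assume f: "f \<in> Lp_space M p"
  note [measurable] = meas[OF f]
  obtain C where C: "Lp_bounded M p C f" using bdd[OF f] by blast
  show "superposition f \<in> Lp_space M p"
  proof (rule Lp_space_dominated[OF envelope_Lp(1)])
    show "AE y in M. norm (superposition f y) \<le>
        (\<bar>C\<bar> * \<bar>A\<bar> + \<bar>C\<bar> + \<bar>A\<bar>) * norm (complex_of_real (envelope y))"
      using envelope_Lp(2) AE_space
      by eventually_elim
        (use superposition_at(2)[OF meas[OF f] _ _ coeff_bounded[OF C]] in \<open>simp add: envelope_nonneg\<close>)
  qed auto
  {
    fix g assume g: "g \<in> Lp_space M p"
    note [measurable] = meas[OF g]
    obtain D where D: "Lp_bounded M p D g" using bdd[OF g] by blast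
    {
      assume "AE y in M. f y = g y"
      then have "coeff f \<xi> = coeff g \<xi>" if "\<xi> \<in> space N" for \<xi>
        unfolding coeff_def using that by (intro integral_cong_AE) auto
      then have "superposition f y = superposition g y" for y
        unfolding superposition_def by (intro Bochner_Integration.integral_cong) auto
      then show "AE y in M. superposition f y = superposition g y" by simp
    }
    have add: "coeff (\<lambda>x. f x + g x) \<xi> = coeff f \<xi> + coeff g \<xi>" if "\<xi> \<in> space N" for \<xi>
      unfolding coeff_def
      using coeff_integrable[OF C that] coeff_integrable[OF D that] by (simp add: distrib_right)
    show "AE y in M. superposition (\<lambda>x. f x + g x) y = superposition f y + superposition g y"
      using envelope_Lp(2) AE_space
    proof eventually_elim
      case (elim y)
      have "superposition (\<lambda>x. f x + g x) y =
          (\<integral>\<xi>. s \<xi> * coeff f \<xi> * Q \<xi> y + s \<xi> * coeff g \<xi> * Q \<xi> y \<partial>N)"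
        unfolding superposition_def
        by (intro Bochner_Integration.integral_cong) (auto simp: add algebra_simps)
      also have "\<dots> = superposition f y + superposition g y"
        unfolding superposition_def
        by (intro Bochner_Integration.integral_add
            superposition_at(1)[OF meas[OF f] elim(2,1) coeff_bounded[OF C]]
            superposition_at(1)[OF meas[OF g] elim(2,1) coeff_bounded[OF D]])
      finally show ?case .
    qed
  }
  fix c
  have "coeff (\<lambda>x. c * f x) \<xi> = c * coeff f \<xi>" for \<xi>
    unfolding coeff_def by (simp add: mult.assoc)
  then have "superposition (\<lambda>x. c * f x) y = (\<integral>\<xi>. c * (s \<xi> * coeff f \<xi> * Q \<xi> y) \<partial>N)" for y
    unfolding superposition_def
    by (intro Bochner_Integration.integral_cong) (auto simp: mult_ac)
  then show "AE y in M. superposition (\<lambda>x. c * f x) y = c * superposition f y"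
    by (simp add: superposition_def)
qed

text \<open>
  The coefficients \<open>\<langle>f\<^sub>n, P\<^sub>\<xi>\<rangle>\<close> are bounded functions of \<open>\<xi>\<close>, so a subsequence of them converges
  weak-* in \<open>L\<^sup>\<infinity>(d\<xi>)\<close>. For almost every \<open>y\<close> the function \<open>s(\<xi>) Q\<^sub>\<xi>(y)\<close> is integrable in \<open>\<xi>\<close>, and
  testing against it gives pointwise convergence of the images. The envelope dominates them in
  \<open>L\<^sup>p\<close>. This covers \<open>p = 1\<close>, where the \<open>f\<^sub>n\<close> themselves may have no weakly
  convergent subsequence.
\<close>

lemma subsequence_converges_finite_exponent:
  fixes f :: "nat \<Rightarrow> 'a \<Rightarrow> complex"
  assumes "p \<noteq> \<infinity>" and f: "\<And>n. Lp_bounded M p C (f n)"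
  shows "\<exists>r g. strict_mono r \<and> g \<in> Lp_space M p \<and>
    (\<lambda>n. Lp_norm M p (\<lambda>y. superposition (f (r n)) y - g y)) \<longlonglongrightarrow> 0"
proof -
  obtain a where a: "p = ennreal a" "0 \<le> a" using assms(1) by (cases p) auto
  with p have a1: "1 \<le> a" by (simp flip: ennreal_1)
  have fm [measurable]: "f n \<in> borel_measurable M" for n using f by (simp add: Lp_bounded_def)
  define K where "K = \<bar>C\<bar> * \<bar>A\<bar> + \<bar>C\<bar> + \<bar>A\<bar>"
  have K: "norm (coeff (f n) \<xi>) \<le> K" if "\<xi> \<in> space N" for n \<xi>
    using coeff_bounded[OF f that] by (simp add: K_def)
  have K0: "0 \<le> K" by (simp add: K_def)
  obtain r where r: "strict_mono r"
    and conv: "\<And>h. integrable N h \<Longrightarrow> convergent (\<lambda>n. \<integral>\<xi>. h \<xi> * coeff (f (r n)) \<xi> \<partial>N)"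
    by (rule weak_star_subsequence[OF N.sigma_finite_measure_axioms gen_N, of "\<lambda>n. coeff (f n)" K])
      (use K in auto)
  \<comment> \<open>Where the limit does not exist, \<open>lim\<close> is an arbitrary value; this is a null set.\<close>
  define g where "g y = lim (\<lambda>n. superposition (f (r n)) y)" for y
  have [measurable]: "g \<in> borel_measurable M" unfolding g_def[abs_def] by measurable
  have lim: "AE y in M. (\<lambda>n. superposition (f (r n)) y) \<longlonglongrightarrow> g y \<and>
      (\<forall>n. norm (superposition (f (r n)) y) \<le> K * envelope y) \<and> norm (g y) \<le> K * envelope y"
    using envelope_Lp(2) AE_space
  proof eventually_elim
    case (elim y)
    have "(\<lambda>n. superposition (f (r n)) y) = (\<lambda>n. \<integral>\<xi>. (s \<xi> * Q \<xi> y) * coeff (f (r n)) \<xi> \<partial>N)"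
      unfolding superposition_def by (simp add: mult_ac)
    then have "convergent (\<lambda>n. superposition (f (r n)) y)" using conv[OF elim(1)] by simp
    then have 1: "(\<lambda>n. superposition (f (r n)) y) \<longlonglongrightarrow> g y"
      unfolding g_def by (simp add: convergent_LIMSEQ_iff)
    have 2: "norm (superposition (f (r n)) y) \<le> K * envelope y" for n
      by (rule superposition_at(2)[OF fm elim(2,1) K])
    have "norm (g y) \<le> K * envelope y"
      by (rule Lim_bounded[OF tendsto_norm[OF 1]]) (use 2 in auto)
    then show ?case using 1 2 by blast
  qed
  have "g \<in> Lp_space M p"
  proof (rule Lp_space_dominated[OF envelope_Lp(1) _ K0])
    show "AE y in M. norm (g y) \<le> K * norm (complex_of_real (envelope y))"
      using lim by eventually_elim (simp add: envelope_nonneg)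
  qed measurable
  moreover have "(\<lambda>n. Lp_norm M p (\<lambda>y. superposition (f (r n)) y - g y)) \<longlonglongrightarrow> 0"
  proof -
    have "(\<lambda>n. \<integral>y. norm (superposition (f (r n)) y - g y) powr a \<partial>M) \<longlonglongrightarrow> (\<integral>y. 0 \<partial>M)"
    proof (rule integral_dominated_convergence[where w="\<lambda>y. (2 * K) powr a * envelope y powr a"])
      show "integrable M (\<lambda>y. (2 * K) powr a * envelope y powr a)"
        using envelope_Lp(1) a by (simp add: Lp_space_def envelope_nonneg)
      show "AE y in M. (\<lambda>n. norm (superposition (f (r n)) y - g y) powr a) \<longlonglongrightarrow> 0"
        using lim
      proof eventually_elim
        case (elim y)
        then have "(\<lambda>n. superposition (f (r n)) y) \<longlonglongrightarrow> g y" by blast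
        then have "(\<lambda>n. norm (superposition (f (r n)) y - g y)) \<longlonglongrightarrow> 0"
          by (simp add: LIM_zero tendsto_norm_zero)
        then have "(\<lambda>n. norm (superposition (f (r n)) y - g y) powr a) \<longlonglongrightarrow> 0 powr a"
          using a1 by (intro tendsto_powr2) (auto intro: tendsto_const)
        then show ?case by simp
      qed
      fix n
      show "AE y in M. norm (norm (superposition (f (r n)) y - g y) powr a) \<le>
          (2 * K) powr a * envelope y powr a"
        using lim
      proof eventually_elim
        case (elim y)
        have "norm (superposition (f (r n)) y - g y) \<le> norm (superposition (f (r n)) y) + norm (g y)"
          by (rule norm_triangle_ineq4)
        also have "\<dots> \<le> K * envelope y + K * envelope y"
          using elim by (intro add_mono) auto
        finally have "norm (superposition (f (r n)) y - g y) powr a \<le> (2 * K * envelope y) powr a"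
          using a by (intro powr_mono2) auto
        also have "\<dots> = (2 * K) powr a * envelope y powr a"
          using K0 envelope_nonneg[of y] by (simp add: powr_mult)
        finally show ?case by simp
      qed
    qed auto
    then have "(\<lambda>n. (\<integral>y. norm (superposition (f (r n)) y - g y) powr a \<partial>M) powr (1 / a)) \<longlonglongrightarrow> 0 powr (1 / a)"
      using a1 by (intro tendsto_powr2) (auto intro: tendsto_const)
    then show ?thesis using a by (simp add: Lp_norm_def)
  qed
  ultimately show ?thesis using r by blast
qed

text \<open>
  Dominated convergence in \<open>y\<close> does not give uniform convergence, so for \<open>p = \<infinity>\<close> the extraction is
  done one step earlier: the \<open>f\<^sub>n\<close> themselves are bounded in \<open>L\<^sup>\<infinity>\<close>, and each \<open>P\<^sub>\<xi>\<close> lies in \<open>L\<^sup>1\<close>. After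
  passing to a weak-* convergent subsequence the coefficients converge at every \<open>\<xi>\<close>, to \<open>U\<close> say,
  and \<open>|superposition f\<^sub>n - g| \<le> B \<integral> |s| |coeff f\<^sub>n - U|\<close> tends to \<open>0\<close> uniformly outside
  null sets of \<open>y\<close>.
\<close>

lemma subsequence_converges_infinite_exponent:
  fixes f :: "nat \<Rightarrow> 'a \<Rightarrow> complex"
  assumes top: "p = \<infinity>" and f: "\<And>n. Lp_bounded M p C (f n)"
  shows "\<exists>r g. strict_mono r \<and> g \<in> Lp_space M p \<and>
    (\<lambda>n. Lp_norm M p (\<lambda>y. superposition (f (r n)) y - g y)) \<longlonglongrightarrow> 0"
proof -
  have q: "q = 1" by (rule conjugate_exponent_cases[OF p pq]) (use top in auto)
  have fm [measurable]: "f n \<in> borel_measurable M" for n using f by (simp add: Lp_bounded_def)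
  define K where "K = \<bar>C\<bar> * \<bar>A\<bar> + \<bar>C\<bar> + \<bar>A\<bar>"
  have K: "norm (coeff (f n) \<xi>) \<le> K" if "\<xi> \<in> space N" for n \<xi>
    using coeff_bounded[OF f that] by (simp add: K_def)
  have K0: "0 \<le> K" by (simp add: K_def)
  have fC: "AE y in M. norm (f n y) \<le> C" for n using f[of n] top by (simp add: Lp_bounded_def)
  obtain r where r: "strict_mono r"
    and conv: "\<And>h. integrable M h \<Longrightarrow> convergent (\<lambda>n. \<integral>y. h y * f (r n) y \<partial>M)"
    by (rule weak_star_subsequence[OF M.sigma_finite_measure_axioms gen_M, of f C])
      (use fC in auto)
  define U where "U \<xi> = lim (\<lambda>n. coeff (f (r n)) \<xi>)" for \<xi>
  have U [measurable]: "U \<in> borel_measurable N" unfolding U_def[abs_def] by measurable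
  have lim: "(\<lambda>n. coeff (f (r n)) \<xi>) \<longlonglongrightarrow> U \<xi>" if \<xi>: "\<xi> \<in> space N" for \<xi>
  proof -
    have "P \<xi> \<in> borel_measurable M" using P_bounded[OF \<xi>] by (simp add: Lp_bounded_def)
    moreover have "(\<integral>\<^sup>+z. ennreal (norm (P \<xi> z)) \<partial>M) < \<infinity>"
      using P_bounded[OF \<xi>] q by (auto simp: Lp_bounded_def intro: le_less_trans)
    ultimately have "integrable M (P \<xi>)" by (simp add: integrable_iff_bounded)
    from conv[OF this] have "convergent (\<lambda>n. coeff (f (r n)) \<xi>)"
      unfolding coeff_def by (simp add: mult.commute)
    then show ?thesis unfolding U_def by (simp add: convergent_LIMSEQ_iff)
  qed
  have UK: "norm (U \<xi>) \<le> K" if "\<xi> \<in> space N" for \<xi>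
    by (rule Lim_bounded[OF tendsto_norm[OF lim[OF that]]]) (use K[OF that] in auto)
  define g where "g y = (\<integral>\<xi>. s \<xi> * U \<xi> * Q \<xi> y \<partial>N)" for y
  have [measurable]: "g \<in> borel_measurable M" unfolding g_def[abs_def] by measurable
  have int_g: "integrable N (\<lambda>\<xi>. s \<xi> * U \<xi> * Q \<xi> y) \<and> norm (g y) \<le> K * envelope y"
    if int: "integrable N (\<lambda>\<xi>. s \<xi> * Q \<xi> y)" for y
  proof -
    have ae: "AE \<xi> in N. norm (U \<xi>) \<le> K" using UK by simp
    show ?thesis
      using integrable_mult_AE_bounded[OF int U ae]
      by (simp add: mult_ac g_def envelope_def)
  qed
  have "g \<in> Lp_space M p"
  proof (rule Lp_space_dominated[OF envelope_Lp(1) _ K0])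
    show "AE y in M. norm (g y) \<le> K * norm (complex_of_real (envelope y))"
      using envelope_Lp(2) by eventually_elim (use int_g in \<open>simp add: envelope_nonneg\<close>)
  qed measurable
  moreover have "(\<lambda>n. Lp_norm M p (\<lambda>y. superposition (f (r n)) y - g y)) \<longlonglongrightarrow> 0"
  proof -
    define d where "d n = (\<integral>\<xi>. norm (s \<xi>) * norm (coeff (f (r n)) \<xi> - U \<xi>) \<partial>N)" for n
    have dom: "norm (s \<xi>) * norm (coeff (f (r n)) \<xi> - U \<xi>) \<le> norm (s \<xi>) * (2 * K)"
      if "\<xi> \<in> space N" for n \<xi>
    proof -
      have "norm (coeff (f (r n)) \<xi> - U \<xi>) \<le> 2 * K"
        using norm_triangle_ineq4[of "coeff (f (r n)) \<xi>" "U \<xi>"] K[OF that, of "r n"] UK[OF that]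
        by linarith
      then show ?thesis by (intro mult_left_mono) auto
    qed
    have int_d: "integrable N (\<lambda>\<xi>. norm (s \<xi>) * norm (coeff (f (r n)) \<xi> - U \<xi>))" for n
    proof (rule Bochner_Integration.integrable_bound)
      show "integrable N (\<lambda>\<xi>. norm (s \<xi>) * (2 * K))" using s by simp
      show "AE \<xi> in N. norm (norm (s \<xi>) * norm (coeff (f (r n)) \<xi> - U \<xi>)) \<le> norm (norm (s \<xi>) * (2 * K))"
        using dom K0 by (intro AE_I2) simp
    qed measurable
    have "d \<longlonglongrightarrow> (\<integral>\<xi>. 0 \<partial>N)"
      unfolding d_def[abs_def]
    proof (rule integral_dominated_convergence[where w="\<lambda>\<xi>. norm (s \<xi>) * (2 * K)"])
      show "AE \<xi> in N. (\<lambda>n. norm (s \<xi>) * norm (coeff (f (r n)) \<xi> - U \<xi>)) \<longlonglongrightarrow> 0"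
      proof (rule AE_I2)
        fix \<xi> assume "\<xi> \<in> space N"
        then have "(\<lambda>n. norm (s \<xi>) * norm (coeff (f (r n)) \<xi> - U \<xi>)) \<longlonglongrightarrow> norm (s \<xi>) * norm (U \<xi> - U \<xi>)"
          by (intro tendsto_intros lim)
        then show "(\<lambda>n. norm (s \<xi>) * norm (coeff (f (r n)) \<xi> - U \<xi>)) \<longlonglongrightarrow> 0" by simp
      qed
    qed (use s dom in auto)
    then have d0: "d \<longlonglongrightarrow> 0" by simp
    have bd0: "AE y in M. norm (superposition (f (r n)) y - g y) \<le> B * d n" for n
      using envelope_Lp(2) AE_Q_bounded[OF top] AE_space
    proof eventually_elim
      case (elim y)
      have [measurable]: "(\<lambda>\<xi>. Q \<xi> y) \<in> borel_measurable N" using elim(3) by measurable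
      have "superposition (f (r n)) y - g y =
          (\<integral>\<xi>. s \<xi> * coeff (f (r n)) \<xi> * Q \<xi> y - s \<xi> * U \<xi> * Q \<xi> y \<partial>N)"
        unfolding superposition_def g_def
        by (intro Bochner_Integration.integral_diff[symmetric])
          (use superposition_at(1)[OF fm elim(3,1) K] int_g[OF elim(1)] in auto)
      also have "\<dots> = (\<integral>\<xi>. (s \<xi> * (coeff (f (r n)) \<xi> - U \<xi>)) * Q \<xi> y \<partial>N)"
        by (simp add: algebra_simps)
      also have "norm \<dots> \<le> B * (\<integral>\<xi>. norm (s \<xi> * (coeff (f (r n)) \<xi> - U \<xi>)) \<partial>N)"
      proof (rule integrable_mult_AE_bounded(2))
        show "integrable N (\<lambda>\<xi>. s \<xi> * (coeff (f (r n)) \<xi> - U \<xi>))"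
          by (rule Bochner_Integration.integrable_bound[OF int_d[of n]]) (auto simp: norm_mult)
      qed (use elim in auto)
      finally show ?case by (simp add: d_def norm_mult)
    qed
    have bd: "AE y in M. norm (superposition (f (r n)) y - g y) \<le> \<bar>B\<bar> * d n" for n
    proof -
      have "0 \<le> d n" by (simp add: d_def)
      then have "B * d n \<le> \<bar>B\<bar> * d n" by (intro mult_right_mono) auto
      then show ?thesis using bd0[of n] by (auto elim: eventually_mono)
    qed
    have le: "norm (Lp_norm M p (\<lambda>y. superposition (f (r n)) y - g y)) \<le> \<bar>B\<bar> * d n" for n
    proof -
      have d: "0 \<le> \<bar>B\<bar> * d n" by (simp add: d_def)
      have "esssup M (\<lambda>y. ennreal (norm (superposition (f (r n)) y - g y))) \<le> ennreal (\<bar>B\<bar> * d n)"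
        by (rule esssup_I) (use bd[of n] in \<open>auto elim!: eventually_mono intro: ennreal_leI\<close>)
      then have "enn2real (esssup M (\<lambda>y. ennreal (norm (superposition (f (r n)) y - g y)))) \<le> \<bar>B\<bar> * d n"
        using d by (metis enn2real_ennreal enn2real_mono ennreal_less_top)
      then show ?thesis using top by (simp add: Lp_norm_def)
    qed
    have "(\<lambda>n. \<bar>B\<bar> * d n) \<longlonglongrightarrow> 0" using tendsto_mult_right_zero[OF d0] .
    then show ?thesis
      by (rule Lim_null_comparison[rotated]) (rule always_eventually, rule allI, rule le)
  qed
  ultimately show ?thesis using r by blast
qed

theorem superposition_compact: "compact_operator_Lp M p superposition"
  unfolding compact_operator_Lp_def
proof (intro conjI allI impI superposition_linear)
  fix f :: "nat \<Rightarrow> 'a \<Rightarrow> complex"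
  assume f: "\<forall>n. f n \<in> Lp_space M p" and "\<exists>C. \<forall>n. Lp_norm M p (f n) \<le> C"
  then obtain C where C: "\<And>n. Lp_norm M p (f n) \<le> C" by blast
  have bdd: "Lp_bounded M p (if p = \<infinity> then C else C powr enn2real p) (f n)" for n
    using Lp_space_imp_Lp_bounded[OF p _ C] f by blast
  show "\<exists>r g. strict_mono r \<and> g \<in> Lp_space M p \<and>
      (\<lambda>n. Lp_norm M p (\<lambda>y. superposition (f (r n)) y - g y)) \<longlonglongrightarrow> 0"
  proof (cases "p = \<infinity>")
    case True
    show ?thesis by (rule subsequence_converges_infinite_exponent[where f=f, OF True bdd])
  next
    case False
    show ?thesis by (rule subsequence_converges_finite_exponent[where f=f, OF False bdd])
  qed
qed

end

section \<open>Polar coordinates and radial translation\<close>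

text \<open>
  The substitution \<open>\<theta> = arccot t\<close>, written with \<open>arctan\<close>. The substitution rule applies to compact
  intervals; both sides are measures of increasing unions of such intervals.
\<close>

lemma nn_integral_arccot_substitution:
  fixes H :: "real \<Rightarrow> ennreal"
  assumes [measurable]: "H \<in> borel_measurable borel"
  shows "(\<integral>\<^sup>+\<theta>. H \<theta> * indicator {0<..<pi} \<theta> \<partial>lborel) =
    (\<integral>\<^sup>+t. H (pi / 2 - arctan t) * ennreal (1 / (1 + t\<^sup>2)) \<partial>lborel)"
proof -
  define h where "h \<phi> = H (pi / 2 - \<phi>)" for \<phi>
  have [measurable]: "h \<in> borel_measurable borel" unfolding h_def[abs_def] by measurable
  define k where "k t = h (arctan t) * ennreal (1 / (1 + t\<^sup>2))" for t
  have [measurable]: "k \<in> borel_measurable borel"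
    unfolding k_def[abs_def] by (intro borel_measurable_times_ennreal measurable_compose[OF _ measurable_ennreal]
      measurable_compose[OF borel_measurable_continuous_onI[of arctan] \<open>h \<in> borel_measurable borel\<close>])
      (auto intro!: continuous_intros)
  let ?A = "\<lambda>n. {arctan (- real (Suc n))..arctan (real (Suc n))}"
  let ?B = "\<lambda>n. {- real (Suc n)..real (Suc n)}"
  have eq: "emeasure (density lborel h) (?A n) = emeasure (density lborel k) (?B n)" for n
  proof -
    have "(\<integral>\<^sup>+x. h x * indicator (?A n) x \<partial>lborel) =
        (\<integral>\<^sup>+x. h (arctan x) * ennreal (1 / (1 + x\<^sup>2)) * indicator (?B n) x \<partial>lborel)"
      by (rule nn_integral_substitution_aux)
        (auto intro!: derivative_eq_intros continuous_intros simp: field_simps add_nonneg_eq_0_iff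
          power2_eq_square inverse_eq_divide)
    then show ?thesis by (simp add: emeasure_density k_def)
  qed
  have "(SUP n. emeasure (density lborel h) (?A n)) = emeasure (density lborel h) (\<Union>n. ?A n)"
  proof (rule SUP_emeasure_incseq)
    show "incseq ?A"
      unfolding incseq_def
    proof (intro allI impI)
      fix m n :: nat assume "m \<le> n"
      then have "arctan (- real (Suc n)) \<le> arctan (- real (Suc m))"
        "arctan (real (Suc m)) \<le> arctan (real (Suc n))"
        by (simp_all only: arctan_le_iff)
      then show "?A m \<subseteq> ?A n" by (simp only: atLeastatMost_subset_iff) simp
    qed
  qed auto
  moreover have "(SUP n. emeasure (density lborel k) (?B n)) = emeasure (density lborel k) (\<Union>n. ?B n)"
    by (rule SUP_emeasure_incseq) (auto simp: incseq_def)
  moreover have "(\<Union>n. ?A n) = {- (pi / 2)<..<pi / 2}"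
  proof (intro antisym subsetI)
    fix x assume "x \<in> (\<Union>n. ?A n)"
    then obtain n where "arctan (- real (Suc n)) \<le> x" "x \<le> arctan (real (Suc n))" by auto
    then show "x \<in> {- (pi / 2)<..<pi / 2}"
      using arctan_lbound[of "- real (Suc n)"] arctan_ubound[of "real (Suc n)"]
      unfolding greaterThanLessThan_iff by linarith
  next
    fix x :: real assume x: "x \<in> {- (pi / 2)<..<pi / 2}"
    obtain n where "\<bar>tan x\<bar> \<le> real n" using real_arch_simple by blast
    then have "- real (Suc n) \<le> tan x" "tan x \<le> real (Suc n)" by auto
    then have "arctan (- real (Suc n)) \<le> arctan (tan x)" "arctan (tan x) \<le> arctan (real (Suc n))"
      by (simp_all only: arctan_le_iff)
    moreover have "arctan (tan x) = x" using x by (intro arctan_tan) auto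
    ultimately show "x \<in> (\<Union>n. ?A n)" by auto
  qed
  moreover have "(\<Union>n. ?B n) = UNIV"
  proof (intro antisym subsetI)
    fix x :: real
    obtain n where "\<bar>x\<bar> \<le> real n" using real_arch_simple by blast
    then show "x \<in> (\<Union>n. ?B n)" by (auto intro!: exI[of _ n])
  qed simp
  ultimately have "emeasure (density lborel h) {- (pi / 2)<..<pi / 2} = emeasure (density lborel k) UNIV"
    using eq by simp
  then have "(\<integral>\<^sup>+x. h x * indicator {- (pi / 2)<..<pi / 2} x \<partial>lborel) = (\<integral>\<^sup>+t. k t \<partial>lborel)"
    by (simp add: emeasure_density)
  moreover have "(\<integral>\<^sup>+\<theta>. H \<theta> * indicator {0<..<pi} \<theta> \<partial>lborel) =
      (\<integral>\<^sup>+x. h x * indicator {- (pi / 2)<..<pi / 2} x \<partial>lborel)"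
  proof -
    have "(\<integral>\<^sup>+\<theta>. H \<theta> * indicator {0<..<pi} \<theta> \<partial>lborel) =
        \<bar>- 1 :: real\<bar> * (\<integral>\<^sup>+x. H (pi / 2 + (- 1) * x) * indicator {0<..<pi} (pi / 2 + (- 1) * x) \<partial>lborel)"
      by (rule nn_integral_real_affine) auto
    also have "\<dots> = (\<integral>\<^sup>+x. h x * indicator {- (pi / 2)<..<pi / 2} x \<partial>lborel)"
      by (auto simp: h_def intro!: nn_integral_cong split: split_indicator)
    finally show ?thesis .
  qed
  ultimately show ?thesis by (simp add: k_def h_def)
qed

text \<open>
  Polar coordinates in the upper half-plane. With \<open>t = cot \<theta>\<close> the change of variables decomposes into
  one-dimensional ones: at fixed \<open>t\<close> the height is \<open>v = y / sqrt (1 + t\<^sup>2)\<close>, and at fixed \<open>v\<close> the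
  abscissa is \<open>u = t v\<close>, both linear. Tonelli moves between the orders of integration.
\<close>

lemma nn_integral_polar:
  fixes F :: "real \<times> real \<Rightarrow> ennreal"
  assumes [measurable]: "F \<in> borel_measurable borel"
  shows "(\<integral>\<^sup>+y. (\<integral>\<^sup>+\<theta>. F (y * cos \<theta>, y * sin \<theta>) * ennreal y * indicator {0<..<pi} \<theta> \<partial>lborel)
        * indicator {0<..} y \<partial>lborel) =
    (\<integral>\<^sup>+v. (\<integral>\<^sup>+u. F (u, v) \<partial>lborel) * indicator {0<..} v \<partial>lborel)"
proof -
  have [measurable]: "(arctan :: real \<Rightarrow> real) \<in> borel_measurable borel"
    by (intro borel_measurable_continuous_onI continuous_intros)
  let ?c = "\<lambda>t::real. sqrt (1 + t\<^sup>2)"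
  have c: "0 < ?c t" "?c t * ?c t = 1 + t\<^sup>2" "1 + t\<^sup>2 \<noteq> 0" for t
  proof -
    have "0 < 1 + t\<^sup>2" by (simp add: add_pos_nonneg)
    then show "0 < ?c t" "?c t * ?c t = 1 + t\<^sup>2" "1 + t\<^sup>2 \<noteq> 0" by auto
  qed
  have "(\<integral>\<^sup>+y. (\<integral>\<^sup>+\<theta>. F (y * cos \<theta>, y * sin \<theta>) * ennreal y * indicator {0<..<pi} \<theta> \<partial>lborel)
        * indicator {0<..} y \<partial>lborel) =
      (\<integral>\<^sup>+y. (\<integral>\<^sup>+t. F (y * (t / ?c t), y * (1 / ?c t)) * ennreal y * ennreal (1 / (1 + t\<^sup>2)) \<partial>lborel)
        * indicator {0<..} y \<partial>lborel)"
    by (subst nn_integral_arccot_substitution)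
      (auto simp: cos_diff sin_diff sin_arctan cos_arctan)
  also have "\<dots> = (\<integral>\<^sup>+y. (\<integral>\<^sup>+t. F (y * (t / ?c t), y * (1 / ?c t)) * ennreal y * ennreal (1 / (1 + t\<^sup>2))
        * indicator {0<..} y \<partial>lborel) \<partial>lborel)"
    by (intro nn_integral_cong nn_integral_multc[symmetric]) measurable
  also have "\<dots> = (\<integral>\<^sup>+t. (\<integral>\<^sup>+y. F (y * (t / ?c t), y * (1 / ?c t)) * ennreal y * ennreal (1 / (1 + t\<^sup>2))
        * indicator {0<..} y \<partial>lborel) \<partial>lborel)"
    by (rule lborel_pair.Fubini') measurable
  also have "\<dots> = (\<integral>\<^sup>+t. (\<integral>\<^sup>+v. F (t * v, v) * ennreal v * indicator {0<..} v \<partial>lborel) \<partial>lborel)"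
  proof (rule nn_integral_cong)
    fix t :: real
    have "(\<integral>\<^sup>+y. F (y * (t / ?c t), y * (1 / ?c t)) * ennreal y * ennreal (1 / (1 + t\<^sup>2))
        * indicator {0<..} y \<partial>lborel) =
      \<bar>?c t\<bar> * (\<integral>\<^sup>+v. F ((0 + ?c t * v) * (t / ?c t), (0 + ?c t * v) * (1 / ?c t)) * ennreal (0 + ?c t * v)
        * ennreal (1 / (1 + t\<^sup>2)) * indicator {0<..} (0 + ?c t * v) \<partial>lborel)"
      by (rule nn_integral_real_affine) (use c(1)[of t] in auto)
    also have "\<dots> = (\<integral>\<^sup>+v. \<bar>?c t\<bar> * (F ((0 + ?c t * v) * (t / ?c t), (0 + ?c t * v) * (1 / ?c t)) * ennreal (0 + ?c t * v)
        * ennreal (1 / (1 + t\<^sup>2)) * indicator {0<..} (0 + ?c t * v)) \<partial>lborel)"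
      by (rule nn_integral_cmult[symmetric]) measurable
    also have "\<dots> = (\<integral>\<^sup>+v. F (t * v, v) * ennreal v * indicator {0<..} v \<partial>lborel)"
    proof (rule nn_integral_cong)
      fix v :: real
      show "\<bar>?c t\<bar> * (F ((0 + ?c t * v) * (t / ?c t), (0 + ?c t * v) * (1 / ?c t)) * ennreal (0 + ?c t * v)
        * ennreal (1 / (1 + t\<^sup>2)) * indicator {0<..} (0 + ?c t * v)) =
        F (t * v, v) * ennreal v * indicator {0<..} v"
      proof (cases "0 < v")
        case True
        then have pos: "0 < ?c t * v" using c(1)[of t] by simp
        have args: "(0 + ?c t * v) * (t / ?c t) = t * v" "(0 + ?c t * v) * (1 / ?c t) = v"
          using c(1)[of t] by auto
        have "ennreal \<bar>?c t\<bar> * ennreal (0 + ?c t * v) * ennreal (1 / (1 + t\<^sup>2)) =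
            ennreal (\<bar>?c t\<bar> * (0 + ?c t * v) * (1 / (1 + t\<^sup>2)))"
          using pos c(1)[of t] by (subst ennreal_mult', simp, simp)+
        also have "\<bar>?c t\<bar> * (0 + ?c t * v) * (1 / (1 + t\<^sup>2)) = v"
          using c[of t] by (simp add: mult.assoc[symmetric])
        finally show ?thesis unfolding args using True pos by (simp add: mult_ac)
      next
        case False
        then have "\<not> 0 < ?c t * v" using c(1)[of t] by (simp add: zero_less_mult_iff)
        then show ?thesis using False by simp
      qed
    qed
    finally show "(\<integral>\<^sup>+y. F (y * (t / ?c t), y * (1 / ?c t)) * ennreal y * ennreal (1 / (1 + t\<^sup>2))
        * indicator {0<..} y \<partial>lborel) = (\<integral>\<^sup>+v. F (t * v, v) * ennreal v * indicator {0<..} v \<partial>lborel)" .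
  qed
  also have "\<dots> = (\<integral>\<^sup>+v. (\<integral>\<^sup>+t. F (t * v, v) * ennreal v * indicator {0<..} v \<partial>lborel) \<partial>lborel)"
    by (rule lborel_pair.Fubini') measurable
  also have "\<dots> = (\<integral>\<^sup>+v. (\<integral>\<^sup>+u. F (u, v) \<partial>lborel) * indicator {0<..} v \<partial>lborel)"
  proof (rule nn_integral_cong)
    fix v :: real
    show "(\<integral>\<^sup>+t. F (t * v, v) * ennreal v * indicator {0<..} v \<partial>lborel) =
        (\<integral>\<^sup>+u. F (u, v) \<partial>lborel) * indicator {0<..} v"
    proof (cases "0 < v")
      case True
      then have "(\<integral>\<^sup>+u. F (u, v) \<partial>lborel) = \<bar>v\<bar> * (\<integral>\<^sup>+t. F (0 + v * t, v) \<partial>lborel)"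
        by (intro nn_integral_real_affine) auto
      then show ?thesis using True by (simp add: nn_integral_cmult mult.commute)
    qed simp
  qed
  finally show ?thesis .
qed

text \<open>
  The total mass of \<open>(sin \<theta>)\<^bsup>2\<alpha>\<^esup> d\<theta>\<close> on \<open>(0, \<pi>)\<close>; for \<open>\<alpha> > -1/2\<close> its value is
  \<open>sqrt \<pi> * Gamma (\<alpha> + 1/2) / Gamma (\<alpha> + 1)\<close>, the reciprocal of the constant in the translation.
\<close>

definition angular_mass :: "real \<Rightarrow> ennreal" where
  "angular_mass \<alpha> = (\<integral>\<^sup>+\<theta>. ennreal (sin \<theta> powr (2 * \<alpha>)) * indicator {0<..<pi} \<theta> \<partial>lborel)"

text \<open>
  Translation invariance in the last variable. Read \<open>(y, \<theta>)\<close> as polar coordinates of the point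
  \<open>(u, v)\<close>; then \<open>y\<^bsup>2\<alpha>+1\<^esup> (sin \<theta>)\<^bsup>2\<alpha>\<^esup> dy d\<theta> = v\<^bsup>2\<alpha>\<^esup> du dv\<close> and the argument of \<open>g\<close> is the distance from
  \<open>(-x, 0)\<close> to \<open>(u, v)\<close>. As \<open>v\<^bsup>2\<alpha>\<^esup> du dv\<close> is invariant under shifts of \<open>u\<close>, the value at \<open>x\<close> equals
  the value at \<open>0\<close>, where the integrals separate.
\<close>

lemma nn_integral_radial_translation:
  fixes g :: "real \<Rightarrow> ennreal"
  assumes [measurable]: "g \<in> borel_measurable borel"
  shows "(\<integral>\<^sup>+y. (\<integral>\<^sup>+\<theta>. g (sqrt (x\<^sup>2 + y\<^sup>2 + 2 * x * y * cos \<theta>)) * ennreal (sin \<theta> powr (2 * \<alpha>))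
        * indicator {0<..<pi} \<theta> \<partial>lborel) * ennreal (y powr (2 * \<alpha> + 1)) * indicator {0<..} y \<partial>lborel) =
    angular_mass \<alpha> * (\<integral>\<^sup>+y. g y * ennreal (y powr (2 * \<alpha> + 1)) * indicator {0<..} y \<partial>lborel)"
proof -
  define F where "F x = (\<lambda>(u, v). g (sqrt ((x + u)\<^sup>2 + v\<^sup>2)) * ennreal (v powr (2 * \<alpha>)))" for x :: real
  have F_meas [measurable]: "F x \<in> borel_measurable borel" for x
    unfolding F_def borel_prod[symmetric] by measurable
  define L where "L x = (\<integral>\<^sup>+y. (\<integral>\<^sup>+\<theta>. g (sqrt (x\<^sup>2 + y\<^sup>2 + 2 * x * y * cos \<theta>)) * ennreal (sin \<theta> powr (2 * \<alpha>))
        * indicator {0<..<pi} \<theta> \<partial>lborel) * ennreal (y powr (2 * \<alpha> + 1)) * indicator {0<..} y \<partial>lborel)" for x :: real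
  have L: "L x = (\<integral>\<^sup>+v. (\<integral>\<^sup>+u. F x (u, v) \<partial>lborel) * indicator {0<..} v \<partial>lborel)" for x
  proof -
    have "L x = (\<integral>\<^sup>+y. (\<integral>\<^sup>+\<theta>. F x (y * cos \<theta>, y * sin \<theta>) * ennreal y * indicator {0<..<pi} \<theta> \<partial>lborel)
        * indicator {0<..} y \<partial>lborel)"
      unfolding L_def
    proof (rule nn_integral_cong)
      fix y :: real
      show "(\<integral>\<^sup>+\<theta>. g (sqrt (x\<^sup>2 + y\<^sup>2 + 2 * x * y * cos \<theta>)) * ennreal (sin \<theta> powr (2 * \<alpha>))
          * indicator {0<..<pi} \<theta> \<partial>lborel) * ennreal (y powr (2 * \<alpha> + 1)) * indicator {0<..} y =
        (\<integral>\<^sup>+\<theta>. F x (y * cos \<theta>, y * sin \<theta>) * ennreal y * indicator {0<..<pi} \<theta> \<partial>lborel) * indicator {0<..} y"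
      proof (cases "0 < y")
        case True
        have "(\<integral>\<^sup>+\<theta>. g (sqrt (x\<^sup>2 + y\<^sup>2 + 2 * x * y * cos \<theta>)) * ennreal (sin \<theta> powr (2 * \<alpha>))
            * indicator {0<..<pi} \<theta> \<partial>lborel) * ennreal (y powr (2 * \<alpha> + 1)) =
          (\<integral>\<^sup>+\<theta>. (g (sqrt (x\<^sup>2 + y\<^sup>2 + 2 * x * y * cos \<theta>)) * ennreal (sin \<theta> powr (2 * \<alpha>))
            * indicator {0<..<pi} \<theta>) * ennreal (y powr (2 * \<alpha> + 1)) \<partial>lborel)"
          by (rule nn_integral_multc[symmetric]) measurable
        also have "\<dots> = (\<integral>\<^sup>+\<theta>. F x (y * cos \<theta>, y * sin \<theta>) * ennreal y * indicator {0<..<pi} \<theta> \<partial>lborel)"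
        proof (rule nn_integral_cong)
          fix \<theta> :: real
          show "(g (sqrt (x\<^sup>2 + y\<^sup>2 + 2 * x * y * cos \<theta>)) * ennreal (sin \<theta> powr (2 * \<alpha>))
            * indicator {0<..<pi} \<theta>) * ennreal (y powr (2 * \<alpha> + 1)) =
            F x (y * cos \<theta>, y * sin \<theta>) * ennreal y * indicator {0<..<pi} \<theta>"
          proof (cases "\<theta> \<in> {0<..<pi}")
            case \<theta>: True
            then have s: "0 < sin \<theta>" by (simp add: sin_gt_zero)
            have arg: "(x + y * cos \<theta>)\<^sup>2 + (y * sin \<theta>)\<^sup>2 = x\<^sup>2 + y\<^sup>2 + 2 * x * y * cos \<theta>"
              using sin_cos_squared_add[of \<theta>] by algebra
            have "sin \<theta> powr (2 * \<alpha>) * y powr (2 * \<alpha> + 1) = (y * sin \<theta>) powr (2 * \<alpha>) * y"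
              using True s by (simp add: powr_add powr_mult)
            then have "ennreal (sin \<theta> powr (2 * \<alpha>)) * ennreal (y powr (2 * \<alpha> + 1)) =
                ennreal ((y * sin \<theta>) powr (2 * \<alpha>)) * ennreal y"
              using True by (simp flip: ennreal_mult')
            then show ?thesis using \<theta> by (simp add: F_def arg mult.assoc)
          qed simp
        qed
        finally show ?thesis using True by simp
      qed simp
    qed
    then show ?thesis by (simp add: nn_integral_polar)
  qed
  have "L x = L 0"
  proof -
    have "(\<integral>\<^sup>+u. F x (u, v) \<partial>lborel) = (\<integral>\<^sup>+u. F 0 (u, v) \<partial>lborel)" for v
    proof -
      have "(\<integral>\<^sup>+u. F 0 (u, v) \<partial>lborel) = \<bar>1::real\<bar> * (\<integral>\<^sup>+u. F 0 (x + 1 * u, v) \<partial>lborel)"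
        by (rule nn_integral_real_affine) auto
      then show ?thesis by (simp add: F_def)
    qed
    then show ?thesis by (simp add: L)
  qed
  also have "L 0 = (\<integral>\<^sup>+y. angular_mass \<alpha> * (g y * ennreal (y powr (2 * \<alpha> + 1)) * indicator {0<..} y) \<partial>lborel)"
    unfolding L_def
  proof (rule nn_integral_cong)
    fix y :: real
    show "(\<integral>\<^sup>+\<theta>. g (sqrt (0\<^sup>2 + y\<^sup>2 + 2 * 0 * y * cos \<theta>)) * ennreal (sin \<theta> powr (2 * \<alpha>))
        * indicator {0<..<pi} \<theta> \<partial>lborel) * ennreal (y powr (2 * \<alpha> + 1)) * indicator {0<..} y =
      angular_mass \<alpha> * (g y * ennreal (y powr (2 * \<alpha> + 1)) * indicator {0<..} y)"
    proof (cases "0 < y")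
      case True
      have "(\<integral>\<^sup>+\<theta>. g (sqrt (0\<^sup>2 + y\<^sup>2 + 2 * 0 * y * cos \<theta>)) * ennreal (sin \<theta> powr (2 * \<alpha>))
          * indicator {0<..<pi} \<theta> \<partial>lborel) =
        (\<integral>\<^sup>+\<theta>. g y * (ennreal (sin \<theta> powr (2 * \<alpha>)) * indicator {0<..<pi} \<theta>) \<partial>lborel)"
        using True by (simp add: mult.assoc)
      also have "\<dots> = g y * angular_mass \<alpha>"
        unfolding angular_mass_def by (rule nn_integral_cmult) measurable
      finally show ?thesis by (simp add: mult_ac)
    qed simp
  qed
  also have "\<dots> = angular_mass \<alpha> * (\<integral>\<^sup>+y. g y * ennreal (y powr (2 * \<alpha> + 1)) * indicator {0<..} y \<partial>lborel)"
    by (rule nn_integral_cmult) measurable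
  finally show ?thesis by (simp add: L_def)
qed

text \<open>
  For \<open>\<alpha> < 0\<close> the density is singular at both ends. Integrating \<open>v\<^bsup>2\<alpha>\<^esup>\<close> over the half-disc in polar
  coordinates gives \<open>angular_mass\<close> times \<open>\<integral>\<^sub>0\<^sup>1 y\<^bsup>2\<alpha>+1\<^esup> dy\<close>, and this is at most its integral over the
  box \<open>[-1, 1] \<times> (0, 1]\<close>, which is finite since \<open>2 \<alpha> > -1\<close>.
\<close>

lemma angular_mass_finite:
  assumes "\<alpha> > - 1 / 2"
  shows "angular_mass \<alpha> < \<infinity>"
proof -
  have pint: "(\<integral>\<^sup>+y. ennreal (y powr b) * indicator {0<..1} y \<partial>lborel) = ennreal (1 / (b + 1))" if "b > -1" for b :: real
  proof -
    have "((\<lambda>x::real. x powr b) has_integral (1 powr (b + 1) / (b + 1))) {0..1}"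
      using that by (intro has_integral_powr_from_0) auto
    then have "(\<integral>\<^sup>+x. ennreal (x powr b) * indicator {0..1} x \<partial>lborel) = ennreal (1 / (b + 1))"
      using nn_integral_has_integral_lebesgue[of "{0..1}" "\<lambda>x::real. x powr b"]
      by (simp add: nn_integral_set_ennreal mult.commute)
    moreover have "(\<integral>\<^sup>+x. ennreal (x powr b) * indicator {0..1} x \<partial>lborel) =
        (\<integral>\<^sup>+x. ennreal (x powr b) * indicator {0<..1} x \<partial>lborel)"
      by (intro nn_integral_cong) (auto simp: indicator_def)
    ultimately show ?thesis by simp
  qed
  define F :: "real \<times> real \<Rightarrow> ennreal"
    where "F = (\<lambda>(u, v). ennreal (v powr (2 * \<alpha>)) * indicator {0<..1} v * indicator {-1..1} u)"
  have [measurable]: "F \<in> borel_measurable borel"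
    unfolding F_def borel_prod[symmetric] by measurable
  have "angular_mass \<alpha> * (\<integral>\<^sup>+y. ennreal (y powr (2 * \<alpha> + 1)) * indicator {0<..1} y \<partial>lborel) =
      (\<integral>\<^sup>+y. angular_mass \<alpha> * (ennreal (y powr (2 * \<alpha> + 1)) * indicator {0<..1} y) \<partial>lborel)"
    by (rule nn_integral_cmult[symmetric]) measurable
  also have "\<dots> \<le> (\<integral>\<^sup>+y. (\<integral>\<^sup>+\<theta>. F (y * cos \<theta>, y * sin \<theta>) * ennreal y * indicator {0<..<pi} \<theta> \<partial>lborel)
        * indicator {0<..} y \<partial>lborel)"
  proof (rule nn_integral_mono)
    fix y :: real
    show "angular_mass \<alpha> * (ennreal (y powr (2 * \<alpha> + 1)) * indicator {0<..1} y) \<le>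
      (\<integral>\<^sup>+\<theta>. F (y * cos \<theta>, y * sin \<theta>) * ennreal y * indicator {0<..<pi} \<theta> \<partial>lborel) * indicator {0<..} y"
    proof (cases "y \<in> {0<..1}")
      case True
      have "angular_mass \<alpha> * ennreal (y powr (2 * \<alpha> + 1)) =
          (\<integral>\<^sup>+\<theta>. (ennreal (sin \<theta> powr (2 * \<alpha>)) * indicator {0<..<pi} \<theta>) * ennreal (y powr (2 * \<alpha> + 1)) \<partial>lborel)"
        unfolding angular_mass_def by (rule nn_integral_multc[symmetric]) measurable
      also have "\<dots> = (\<integral>\<^sup>+\<theta>. F (y * cos \<theta>, y * sin \<theta>) * ennreal y * indicator {0<..<pi} \<theta> \<partial>lborel)"
      proof (rule nn_integral_cong)
        fix \<theta> :: real
        show "(ennreal (sin \<theta> powr (2 * \<alpha>)) * indicator {0<..<pi} \<theta>) * ennreal (y powr (2 * \<alpha> + 1)) =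
          F (y * cos \<theta>, y * sin \<theta>) * ennreal y * indicator {0<..<pi} \<theta>"
        proof (cases "\<theta> \<in> {0<..<pi}")
          case \<theta>: True
          then have s: "0 < sin \<theta>" by (simp add: sin_gt_zero)
          have "y * sin \<theta> \<le> 1 * 1" using True s by (intro mult_mono) auto
          moreover have "0 < y * sin \<theta>" using True s by simp
          moreover have "\<bar>y * cos \<theta>\<bar> \<le> 1 * 1"
            unfolding abs_mult using True by (intro mult_mono) auto
          ultimately have "F (y * cos \<theta>, y * sin \<theta>) = ennreal ((y * sin \<theta>) powr (2 * \<alpha>))"
            by (auto simp: F_def abs_le_iff)
          moreover have "sin \<theta> powr (2 * \<alpha>) * y powr (2 * \<alpha> + 1) = (y * sin \<theta>) powr (2 * \<alpha>) * y"
            using True s by (simp add: powr_add powr_mult)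
          then have "ennreal (sin \<theta> powr (2 * \<alpha>)) * ennreal (y powr (2 * \<alpha> + 1)) =
              ennreal ((y * sin \<theta>) powr (2 * \<alpha>)) * ennreal y"
            using True by (simp flip: ennreal_mult')
          ultimately show ?thesis using \<theta> by simp
        qed simp
      qed
      finally show ?thesis using True by simp
    qed simp
  qed
  also have "\<dots> = (\<integral>\<^sup>+v. (\<integral>\<^sup>+u. F (u, v) \<partial>lborel) * indicator {0<..} v \<partial>lborel)"
    by (rule nn_integral_polar) measurable
  also have "\<dots> = (\<integral>\<^sup>+v. ennreal (v powr (2 * \<alpha>)) * indicator {0<..1} v * 2 \<partial>lborel)"
  proof (rule nn_integral_cong)
    fix v :: real
    have "(\<integral>\<^sup>+u. F (u, v) \<partial>lborel) = ennreal (v powr (2 * \<alpha>)) * indicator {0<..1} v * emeasure lborel {-1..1::real}"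
      unfolding F_def by (simp add: nn_integral_cmult)
    then show "(\<integral>\<^sup>+u. F (u, v) \<partial>lborel) * indicator {0<..} v = ennreal (v powr (2 * \<alpha>)) * indicator {0<..1} v * 2"
      by (auto split: split_indicator)
  qed
  also have "\<dots> = ennreal (1 / (2 * \<alpha> + 1)) * 2"
    using assms by (subst nn_integral_multc) (auto simp: pint)
  also have "\<dots> < \<infinity>" by (simp add: ennreal_mult_less_top)
  finally have "angular_mass \<alpha> * ennreal (1 / (2 * \<alpha> + 2)) < \<infinity>"
    using assms by (simp add: pint add.assoc)
  moreover have "ennreal (1 / (2 * \<alpha> + 2)) \<noteq> 0" using assms by simp
  ultimately show ?thesis by (auto simp: ennreal_mult_less_top)
qed

section \<open>The Weinstein measure\<close>

lemma borel_measurable_fst_pair [measurable (raw)]: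
  fixes f :: "'a \<Rightarrow> 'b::second_countable_topology \<times> 'c::second_countable_topology"
  assumes "f \<in> borel_measurable M"
  shows "(\<lambda>x. fst (f x)) \<in> borel_measurable M"
  by (rule measurable_compose[OF assms]) (intro borel_measurable_continuous_onI continuous_intros)

lemma borel_measurable_snd_pair [measurable (raw)]:
  fixes f :: "'a \<Rightarrow> 'b::second_countable_topology \<times> 'c::second_countable_topology"
  assumes "f \<in> borel_measurable M"
  shows "(\<lambda>x. snd (f x)) \<in> borel_measurable M"
  by (rule measurable_compose[OF assms]) (intro borel_measurable_continuous_onI continuous_intros)

lemma sets_weinstein_measure [measurable_cong]:
  "sets (weinstein_measure \<alpha> :: ((real ^ 'd::finite) \<times> real) measure) = sets (restrict_space borel half_space)"
  unfolding weinstein_measure_def by (simp cong: sets_restrict_space_cong)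

lemma half_space_borel [measurable]: "half_space \<in> sets (borel :: ((real ^ 'd::finite) \<times> real) measure)"
proof -
  have "half_space = {x :: (real ^ 'd) \<times> real. 0 < snd x}" by (simp add: half_space_def)
  also have "open \<dots>" by (intro open_Collect_less continuous_intros)
  finally show ?thesis by (rule borel_open)
qed

lemma space_weinstein_measure [simp]: "space (weinstein_measure \<alpha>) = half_space"
  by (simp add: weinstein_measure_def space_restrict_space)

text \<open>
  The first factor of the measure on \<open>(0, \<infinity>) \<times> half_space\<close>.
\<close>

definition dilation_measure :: "real \<Rightarrow> real measure" where
  "dilation_measure e = density (restrict_space lborel {0<..}) (\<lambda>a. ennreal (1 / a powr e))"

lemma sets_dilation_measure [measurable_cong]:
  "sets (dilation_measure e) = sets (restrict_space borel {0<..})"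
  unfolding dilation_measure_def by (simp cong: sets_restrict_space_cong)

lemma weinstein_wavelet_measure_eq:
  "(weinstein_wavelet_measure \<alpha> :: (real \<times> ((real ^ 'd::finite) \<times> real)) measure) =
    dilation_measure (2 * \<alpha> + real CARD('d) + 3) \<Otimes>\<^sub>M weinstein_measure \<alpha>"
  unfolding weinstein_wavelet_measure_def dilation_measure_def ..

lemma space_weinstein_wavelet_measure [simp]:
  "space (weinstein_wavelet_measure \<alpha>) = {0<..} \<times> half_space"
  by (simp add: weinstein_wavelet_measure_def space_pair_measure space_restrict_space)

lemma sigma_finite_weinstein_measure:
  "sigma_finite_measure (weinstein_measure \<alpha> :: ((real ^ 'd::finite) \<times> real) measure)"
proof -
  interpret R: sigma_finite_measure "restrict_space (lborel :: ((real ^ 'd) \<times> real) measure) half_space"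
    by (rule sigma_finite_measure_restrict_space[OF sigma_finite_lborel]) simp
  show ?thesis
    unfolding weinstein_measure_def
    by (subst R.sigma_finite_iff_density_finite) (auto intro!: measurable_restrict_space1)
qed

lemma sigma_finite_dilation_measure: "sigma_finite_measure (dilation_measure e)"
proof -
  interpret R: sigma_finite_measure "restrict_space (lborel :: real measure) {0<..}"
    by (rule sigma_finite_measure_restrict_space[OF sigma_finite_lborel]) simp
  show ?thesis
    unfolding dilation_measure_def
    by (subst R.sigma_finite_iff_density_finite) (auto intro!: measurable_restrict_space1)
qed

lemma sigma_finite_weinstein_wavelet_measure:
  "sigma_finite_measure (weinstein_wavelet_measure \<alpha> :: (real \<times> ((real ^ 'd::finite) \<times> real)) measure)"
proof -
  interpret D: sigma_finite_measure "dilation_measure (2 * \<alpha> + real CARD('d) + 3)"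
    by (rule sigma_finite_dilation_measure)
  interpret W: sigma_finite_measure "weinstein_measure \<alpha> :: ((real ^ 'd) \<times> real) measure"
    by (rule sigma_finite_weinstein_measure)
  interpret P: pair_sigma_finite "dilation_measure (2 * \<alpha> + real CARD('d) + 3)"
    "weinstein_measure \<alpha> :: ((real ^ 'd) \<times> real) measure" ..
  show ?thesis unfolding weinstein_wavelet_measure_eq by (rule P.sigma_finite_measure_axioms)
qed

lemma sets_pair_restrict_space:
  assumes X: "X \<in> sets A" and Y: "Y \<in> sets B"
  shows "sets (restrict_space A X \<Otimes>\<^sub>M restrict_space B Y) = sets (restrict_space (A \<Otimes>\<^sub>M B) (X \<times> Y))"
proof (rule antisym)
  have XY: "X \<subseteq> space A" "Y \<subseteq> space B" using X Y sets.sets_into_space by auto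
  show "sets (restrict_space A X \<Otimes>\<^sub>M restrict_space B Y) \<subseteq> sets (restrict_space (A \<Otimes>\<^sub>M B) (X \<times> Y))"
  proof (rule sets_pair_in_sets)
    fix a b assume "a \<in> sets (restrict_space A X)" "b \<in> sets (restrict_space B Y)"
    then obtain a' b' where ab: "a' \<in> sets A" "b' \<in> sets B" "a = X \<inter> a'" "b = Y \<inter> b'"
      by (auto simp: sets_restrict_space)
    then have "a \<times> b = (X \<times> Y) \<inter> (a' \<times> b')" by auto
    then show "a \<times> b \<in> sets (restrict_space (A \<Otimes>\<^sub>M B) (X \<times> Y))"
      using ab by (auto simp: sets_restrict_space)
  qed
  show "sets (restrict_space (A \<Otimes>\<^sub>M B) (X \<times> Y)) \<subseteq> sets (restrict_space A X \<Otimes>\<^sub>M restrict_space B Y)"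
  proof
    fix Z assume "Z \<in> sets (restrict_space (A \<Otimes>\<^sub>M B) (X \<times> Y))"
    then obtain S where S: "S \<in> sets (A \<Otimes>\<^sub>M B)" "Z = (X \<times> Y) \<inter> S" by (auto simp: sets_restrict_space)
    have "(\<lambda>z. (fst z, snd z)) \<in> restrict_space A X \<Otimes>\<^sub>M restrict_space B Y \<rightarrow>\<^sub>M A \<Otimes>\<^sub>M B"
      by (intro measurable_Pair measurable_compose[OF measurable_fst measurable_restrict_space1]
          measurable_compose[OF measurable_snd measurable_restrict_space1] measurable_ident_sets refl)
    from measurable_sets[OF this S(1)]
    have "(\<lambda>z. (fst z, snd z)) -` S \<inter> space (restrict_space A X \<Otimes>\<^sub>M restrict_space B Y)
        \<in> sets (restrict_space A X \<Otimes>\<^sub>M restrict_space B Y)" .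
    moreover have "(\<lambda>z. (fst z, snd z)) -` S \<inter> space (restrict_space A X \<Otimes>\<^sub>M restrict_space B Y) = Z"
      using XY unfolding S(2) space_pair_measure space_restrict_space by (simp only: prod.collapse) blast
    ultimately show "Z \<in> sets (restrict_space A X \<Otimes>\<^sub>M restrict_space B Y)" by simp
  qed
qed

lemma sets_weinstein_wavelet_measure:
  "sets (weinstein_wavelet_measure \<alpha> :: (real \<times> ((real ^ 'd::finite) \<times> real)) measure) =
    sets (restrict_space borel ({0<..} \<times> half_space))"
proof -
  have "sets (weinstein_wavelet_measure \<alpha> :: (real \<times> ((real ^ 'd::finite) \<times> real)) measure) =
    sets (restrict_space borel {0<..} \<Otimes>\<^sub>M restrict_space borel half_space)"
    unfolding weinstein_wavelet_measure_eq
    by (rule sets_pair_measure_cong[OF sets_dilation_measure sets_weinstein_measure])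
  also have "\<dots> = sets (restrict_space (borel \<Otimes>\<^sub>M borel) ({0<..} \<times> half_space))"
    by (rule sets_pair_restrict_space) auto
  finally show ?thesis by (simp add: borel_prod)
qed

lemma countably_generated_weinstein_measure: "countably_generated (weinstein_measure \<alpha>)"
  by (rule countably_generated_restrict_borel[OF sets_weinstein_measure]) measurable

lemma countably_generated_weinstein_wavelet_measure:
  "countably_generated (weinstein_wavelet_measure \<alpha> :: (real \<times> ((real ^ 'd::finite) \<times> real)) measure)"
proof (rule countably_generated_restrict_borel[OF sets_weinstein_wavelet_measure])
  have "{0<..} \<times> half_space \<in> sets (borel \<Otimes>\<^sub>M (borel :: ((real ^ 'd) \<times> real) measure) :: (real \<times> ((real ^ 'd) \<times> real)) measure)"
    by (intro pair_measureI) auto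
  then show "{0<..} \<times> half_space \<in> sets (borel :: (real \<times> ((real ^ 'd) \<times> real)) measure)"
    unfolding borel_prod .
qed

text \<open>
  The degree of homogeneity of \<open>\<mu>\<^sub>\<alpha>\<close> under the dilations \<open>y \<mapsto> a y\<close>.
\<close>

definition homogeneous_dim :: "real \<Rightarrow> 'd::finite itself \<Rightarrow> real" where
  "homogeneous_dim \<alpha> _ = 2 * \<alpha> + real CARD('d) + 2"

definition weinstein_const :: "real \<Rightarrow> 'd::finite itself \<Rightarrow> real" where
  "weinstein_const \<alpha> _ = (2 * pi) ^ CARD('d) * 2 powr (2 * \<alpha>) * (Gamma (\<alpha> + 1))\<^sup>2"

lemma nn_integral_weinstein_measure:
  fixes G :: "(real ^ 'd::finite) \<times> real \<Rightarrow> ennreal"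
  assumes [measurable]: "G \<in> borel_measurable borel"
  shows "(\<integral>\<^sup>+y. G y \<partial>weinstein_measure \<alpha>) = ennreal (1 / weinstein_const \<alpha> TYPE('d)) *
    (\<integral>\<^sup>+x. (\<integral>\<^sup>+t. G (x, t) * ennreal (t powr (2 * \<alpha> + 1)) * indicator {0<..} t \<partial>lborel) \<partial>lborel)"
proof -
  define \<kappa> where "\<kappa> = weinstein_const \<alpha> TYPE('d)"
  have \<kappa>: "0 \<le> \<kappa>" by (simp add: \<kappa>_def weinstein_const_def)
  have "(\<integral>\<^sup>+y. G y \<partial>weinstein_measure \<alpha>) =
      (\<integral>\<^sup>+y. ennreal (snd y powr (2 * \<alpha> + 1) / \<kappa>) * G y * indicator half_space y \<partial>lborel)"
    unfolding weinstein_measure_def \<kappa>_def weinstein_const_def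
    by (subst nn_integral_density) (auto simp: nn_integral_restrict_space intro!: measurable_restrict_space1)
  also have "\<dots> = (\<integral>\<^sup>+y. ennreal (1 / \<kappa>) * (G y * ennreal (snd y powr (2 * \<alpha> + 1)) * indicator {0<..} (snd y)) \<partial>lborel)"
  proof (rule nn_integral_cong)
    fix y :: "(real ^ 'd) \<times> real"
    have "ennreal (snd y powr (2 * \<alpha> + 1) / \<kappa>) = ennreal (1 / \<kappa>) * ennreal (snd y powr (2 * \<alpha> + 1))"
      using \<kappa> by (subst ennreal_mult'[symmetric]) auto
    then show "ennreal (snd y powr (2 * \<alpha> + 1) / \<kappa>) * G y * indicator half_space y =
        ennreal (1 / \<kappa>) * (G y * ennreal (snd y powr (2 * \<alpha> + 1)) * indicator {0<..} (snd y))"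
      by (simp add: half_space_def indicator_def mult_ac)
  qed
  also have "\<dots> = ennreal (1 / \<kappa>) * (\<integral>\<^sup>+y. G y * ennreal (snd y powr (2 * \<alpha> + 1)) * indicator {0<..} (snd y) \<partial>lborel)"
    by (rule nn_integral_cmult) measurable
  also have "(\<integral>\<^sup>+y. G y * ennreal (snd y powr (2 * \<alpha> + 1)) * indicator {0<..} (snd y) \<partial>lborel) =
      (\<integral>\<^sup>+x. (\<integral>\<^sup>+t. G (x, t) * ennreal (t powr (2 * \<alpha> + 1)) * indicator {0<..} t \<partial>lborel) \<partial>lborel)"
  proof -
    have "(\<lambda>y. G y * ennreal (snd y powr (2 * \<alpha> + 1)) * indicator {0<..} (snd y)) \<in>
        borel_measurable (lborel \<Otimes>\<^sub>M (lborel :: real measure))"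
      unfolding lborel_prod by measurable
    from lborel.nn_integral_fst[OF this] show ?thesis by (simp add: lborel_prod)
  qed
  finally show ?thesis by (simp add: \<kappa>_def)
qed

definition angular_measure :: "real \<Rightarrow> real measure" where
  "angular_measure \<alpha> = density lborel (\<lambda>\<theta>. ennreal (indicator {0<..<pi} \<theta> * sin \<theta> powr (2 * \<alpha>)))"

lemma sets_angular_measure [measurable_cong]: "sets (angular_measure \<alpha>) = sets borel"
  by (simp add: angular_measure_def)

lemma finite_angular_measure:
  assumes "\<alpha> > - 1 / 2" shows "finite_measure (angular_measure \<alpha>)"
proof (rule finite_measureI)
  have "emeasure (angular_measure \<alpha>) (space (angular_measure \<alpha>)) = angular_mass \<alpha>"
    unfolding angular_measure_def angular_mass_def
    by (auto simp: emeasure_density intro!: nn_integral_cong split: split_indicator)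
  then show "emeasure (angular_measure \<alpha>) (space (angular_measure \<alpha>)) \<noteq> \<infinity>"
    using angular_mass_finite[OF assms] by simp
qed

definition angular_shift :: "'v::real_vector \<times> real \<Rightarrow> 'v \<times> real \<Rightarrow> real \<Rightarrow> 'v \<times> real" where
  "angular_shift x y \<theta> =
     (fst x + fst y, sqrt ((snd x)\<^sup>2 + (snd y)\<^sup>2 + 2 * snd x * snd y * cos \<theta>))"

lemma angular_shift_half_space:
  assumes "x \<in> half_space" "y \<in> half_space" "\<theta> \<in> {0<..<pi}"
  shows "angular_shift x y \<theta> \<in> half_space"
proof -
  have "cos pi < cos \<theta>" using assms(3) by (intro cos_monotone_0_pi) auto
  then have "0 < 1 + cos \<theta>" by simp
  then have "0 < 2 * (snd x * snd y) * (1 + cos \<theta>)" using assms by (simp add: half_space_def)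
  moreover have "0 \<le> (snd x - snd y)\<^sup>2" by simp
  ultimately have "0 < (snd x - snd y)\<^sup>2 + 2 * (snd x * snd y) * (1 + cos \<theta>)" by linarith
  also have "\<dots> = (snd x)\<^sup>2 + (snd y)\<^sup>2 + 2 * snd x * snd y * cos \<theta>"
    by (simp add: power2_eq_square algebra_simps)
  finally show ?thesis by (simp add: angular_shift_def half_space_def)
qed

lemma angular_shift_measurable [measurable]:
  fixes f g :: "'a \<Rightarrow> (real ^ 'd::finite) \<times> real"
  assumes [measurable]: "f \<in> borel_measurable M" "g \<in> borel_measurable M" "h \<in> borel_measurable M"
  shows "(\<lambda>z. angular_shift (f z) (g z) (h z)) \<in> borel_measurable M"
proof -
  have [measurable]: "(\<lambda>z. fst (f z)) \<in> borel_measurable M" "(\<lambda>z. snd (f z)) \<in> borel_measurable M"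
    "(\<lambda>z. fst (g z)) \<in> borel_measurable M" "(\<lambda>z. snd (g z)) \<in> borel_measurable M"
    using assms by (auto intro: measurable_compose[OF _ borel_measurable_continuous_onI[OF continuous_on_fst]]
      measurable_compose[OF _ borel_measurable_continuous_onI[OF continuous_on_snd]])
  show ?thesis unfolding angular_shift_def by measurable
qed

text \<open>
  Up to the factor \<open>angular_mass\<close>, the average of \<open>g\<close> over the generalized translation preserves
  integrals: plain translation invariance in the first \<open>d\<close> coordinates, and the polar-coordinate
  argument in the last one.
\<close>

lemma nn_integral_weinstein_translation:
  fixes g :: "(real ^ 'd::finite) \<times> real \<Rightarrow> ennreal"
  assumes [measurable]: "g \<in> borel_measurable borel"
  shows "(\<integral>\<^sup>+y. (\<integral>\<^sup>+\<theta>. g (angular_shift x y \<theta>) \<partial>angular_measure \<alpha>) \<partial>weinstein_measure \<alpha>) =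
    angular_mass \<alpha> * (\<integral>\<^sup>+y. g y \<partial>weinstein_measure \<alpha>)"
proof -
  define H where "H z = (\<integral>\<^sup>+t. g (z, t) * ennreal (t powr (2 * \<alpha> + 1)) * indicator {0<..} t \<partial>lborel)" for z
  have [measurable]: "H \<in> borel_measurable borel" unfolding H_def[abs_def] by measurable
  interpret A: sigma_finite_measure "angular_measure \<alpha>"
    unfolding angular_measure_def 
    by (subst sigma_finite_measure.sigma_finite_iff_density_finite[OF sigma_finite_lborel]) auto
  have "(\<integral>\<^sup>+y. (\<integral>\<^sup>+\<theta>. g (angular_shift x y \<theta>) \<partial>angular_measure \<alpha>) \<partial>weinstein_measure \<alpha>) =
      ennreal (1 / weinstein_const \<alpha> TYPE('d)) * (\<integral>\<^sup>+z. (\<integral>\<^sup>+t. (\<integral>\<^sup>+\<theta>. g (angular_shift x (z, t) \<theta>) \<partial>angular_measure \<alpha>)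
        * ennreal (t powr (2 * \<alpha> + 1)) * indicator {0<..} t \<partial>lborel) \<partial>lborel)"
    by (rule nn_integral_weinstein_measure) measurable
  also have "(\<integral>\<^sup>+z. (\<integral>\<^sup>+t. (\<integral>\<^sup>+\<theta>. g (angular_shift x (z, t) \<theta>) \<partial>angular_measure \<alpha>)
        * ennreal (t powr (2 * \<alpha> + 1)) * indicator {0<..} t \<partial>lborel) \<partial>lborel) =
      (\<integral>\<^sup>+z. angular_mass \<alpha> * H (fst x + z) \<partial>lborel)"
  proof (rule nn_integral_cong)
    fix z :: "real ^ 'd"
    have "(\<integral>\<^sup>+\<theta>. g (angular_shift x (z, t) \<theta>) \<partial>angular_measure \<alpha>) =
        (\<integral>\<^sup>+\<theta>. g (fst x + z, sqrt ((snd x)\<^sup>2 + t\<^sup>2 + 2 * snd x * t * cos \<theta>)) * ensin \<theta> \<partial>lborel)"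
      if "ensin = (\<lambda>\<theta>. ennreal (sin \<theta> powr (2 * \<alpha>)) * indicator {0<..<pi} \<theta>)" for t ensin
      unfolding angular_measure_def that
      by (subst nn_integral_density)
        (auto simp: angular_shift_def mult.commute intro!: nn_integral_cong split: split_indicator)
    then show "(\<integral>\<^sup>+t. (\<integral>\<^sup>+\<theta>. g (angular_shift x (z, t) \<theta>) \<partial>angular_measure \<alpha>)
        * ennreal (t powr (2 * \<alpha> + 1)) * indicator {0<..} t \<partial>lborel) = angular_mass \<alpha> * H (fst x + z)"
      using nn_integral_radial_translation[of "\<lambda>s. g (fst x + z, s)" "snd x" \<alpha>]
      by (simp add: H_def mult.assoc)
  qed
  also have "\<dots> = angular_mass \<alpha> * (\<integral>\<^sup>+z. H (fst x + z) \<partial>lborel)"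
    by (rule nn_integral_cmult) measurable
  also have "(\<integral>\<^sup>+z. H (fst x + z) \<partial>lborel) = (\<integral>\<^sup>+z. H z \<partial>distr lborel borel ((+) (fst x)))"
    by (subst nn_integral_distr) auto
  also have "\<dots> = (\<integral>\<^sup>+z. H z \<partial>lborel)" by (simp add: lborel_distr_plus)
  finally show ?thesis
    by (simp add: nn_integral_weinstein_measure H_def mult_ac)
qed

lemma nn_integral_weinstein_dilation:
  fixes g :: "(real ^ 'd::finite) \<times> real \<Rightarrow> ennreal"
  assumes [measurable]: "g \<in> borel_measurable borel" and a: "0 < a"
  shows "(\<integral>\<^sup>+y. g (y /\<^sub>R a) \<partial>weinstein_measure \<alpha>) =
    ennreal (a powr homogeneous_dim \<alpha> TYPE('d)) * (\<integral>\<^sup>+y. g y \<partial>weinstein_measure \<alpha>)"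
proof -
  define H where "H z = (\<integral>\<^sup>+t. g (z, t) * ennreal (t powr (2 * \<alpha> + 1)) * indicator {0<..} t \<partial>lborel)" for z
  have [measurable]: "H \<in> borel_measurable borel" unfolding H_def[abs_def] by measurable
  have vertical: "(\<integral>\<^sup>+t. g ((z, t) /\<^sub>R a) * ennreal (t powr (2 * \<alpha> + 1)) * indicator {0<..} t \<partial>lborel) =
      ennreal (a powr (2 * \<alpha> + 2)) * H (z /\<^sub>R a)" for z
  proof -
    have "(\<integral>\<^sup>+t. g ((z, t) /\<^sub>R a) * ennreal (t powr (2 * \<alpha> + 1)) * indicator {0<..} t \<partial>lborel) =
        \<bar>a\<bar> * (\<integral>\<^sup>+t. g ((z, 0 + a * t) /\<^sub>R a) * ennreal ((0 + a * t) powr (2 * \<alpha> + 1))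
          * indicator {0<..} (0 + a * t) \<partial>lborel)"
      using a by (intro nn_integral_real_affine) auto
    also have "\<dots> = (\<integral>\<^sup>+t. ennreal \<bar>a\<bar> * (g ((z, 0 + a * t) /\<^sub>R a) * ennreal ((0 + a * t) powr (2 * \<alpha> + 1))
          * indicator {0<..} (0 + a * t)) \<partial>lborel)"
      by (rule nn_integral_cmult[symmetric]) measurable
    also have "\<dots> = (\<integral>\<^sup>+t. ennreal (a powr (2 * \<alpha> + 2)) *
        (g (z /\<^sub>R a, t) * ennreal (t powr (2 * \<alpha> + 1)) * indicator {0<..} t) \<partial>lborel)"
    proof (rule nn_integral_cong)
      fix t :: real
      show "ennreal \<bar>a\<bar> * (g ((z, 0 + a * t) /\<^sub>R a) * ennreal ((0 + a * t) powr (2 * \<alpha> + 1))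
          * indicator {0<..} (0 + a * t)) = ennreal (a powr (2 * \<alpha> + 2)) *
        (g (z /\<^sub>R a, t) * ennreal (t powr (2 * \<alpha> + 1)) * indicator {0<..} t)"
      proof (cases "0 < t")
        case True
        have "a * a powr (2 * \<alpha> + 1) = a powr (2 * \<alpha> + 2)"
          using a powr_mult_base[of a "2 * \<alpha> + 1"] by (simp add: algebra_simps)
        then have "\<bar>a\<bar> * (0 + a * t) powr (2 * \<alpha> + 1) = a powr (2 * \<alpha> + 2) * t powr (2 * \<alpha> + 1)"
          using a True by (simp add: powr_mult)
        then have eq: "ennreal \<bar>a\<bar> * ennreal ((0 + a * t) powr (2 * \<alpha> + 1)) =
            ennreal (a powr (2 * \<alpha> + 2)) * ennreal (t powr (2 * \<alpha> + 1))"
          by (simp only: ennreal_mult'[symmetric] abs_ge_zero powr_ge_zero)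
        have args: "(z, 0 + a * t) /\<^sub>R a = (z /\<^sub>R a, t)"
          "indicator {0<..} (0 + a * t) = (1 :: ennreal)" "indicator {0<..} t = (1 :: ennreal)"
          using a True by simp_all
        have "ennreal \<bar>a\<bar> * (g (z /\<^sub>R a, t) * ennreal ((0 + a * t) powr (2 * \<alpha> + 1)) * 1) =
            g (z /\<^sub>R a, t) * (ennreal \<bar>a\<bar> * ennreal ((0 + a * t) powr (2 * \<alpha> + 1)))"
          by (simp only: mult_1_right mult_1_left mult.left_commute mult.commute mult.assoc)
        also have "\<dots> = ennreal (a powr (2 * \<alpha> + 2)) * (g (z /\<^sub>R a, t) * ennreal (t powr (2 * \<alpha> + 1)) * 1)"
          unfolding eq by (simp only: mult_1_right mult_1_left mult.left_commute mult.commute mult.assoc)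
        finally show ?thesis unfolding args .
      next
        case False
        then have "\<not> 0 < a * t" using a by (simp add: zero_less_mult_iff)
        then show ?thesis using False by simp
      qed
    qed
    also have "\<dots> = ennreal (a powr (2 * \<alpha> + 2)) * H (z /\<^sub>R a)"
      unfolding H_def by (rule nn_integral_cmult) measurable
    finally show ?thesis .
  qed
  have "(\<integral>\<^sup>+z. H (z /\<^sub>R a) \<partial>lborel) = ennreal (a ^ CARD('d)) * (\<integral>\<^sup>+z. H z \<partial>lborel)"
  proof -
    have "(lborel :: (real ^ 'd) measure) = density (distr lborel borel (\<lambda>x. 0 + a *\<^sub>R x)) (\<lambda>_. \<bar>a\<bar> ^ DIM(real ^ 'd))"
      using a by (intro lborel_affine) auto
    then have "(\<integral>\<^sup>+z. H (z /\<^sub>R a) \<partial>lborel) =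
        (\<integral>\<^sup>+z. H (z /\<^sub>R a) \<partial>density (distr lborel borel (\<lambda>x. 0 + a *\<^sub>R x)) (\<lambda>_. \<bar>a\<bar> ^ DIM(real ^ 'd)))"
      by simp
    also have "\<dots> = (\<integral>\<^sup>+z. ennreal (a ^ CARD('d)) * H z \<partial>lborel)"
      using a by (subst nn_integral_density, simp, simp, subst nn_integral_distr) auto
    finally show ?thesis by (simp add: nn_integral_cmult)
  qed
  moreover have "(\<integral>\<^sup>+y. g (y /\<^sub>R a) \<partial>weinstein_measure \<alpha>) =
      ennreal (1 / weinstein_const \<alpha> TYPE('d)) * (\<integral>\<^sup>+z. ennreal (a powr (2 * \<alpha> + 2)) * H (z /\<^sub>R a) \<partial>lborel)"
    by (subst nn_integral_weinstein_measure) (auto simp: vertical simp del: scaleR_Pair)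
  moreover have "(\<integral>\<^sup>+z. ennreal (a powr (2 * \<alpha> + 2)) * H (z /\<^sub>R a) \<partial>lborel) =
      ennreal (a powr (2 * \<alpha> + 2)) * (\<integral>\<^sup>+z. H (z /\<^sub>R a) \<partial>lborel)"
    by (rule nn_integral_cmult) measurable
  moreover have "ennreal (a powr (2 * \<alpha> + 2)) * ennreal (a ^ CARD('d)) =
      ennreal (a powr homogeneous_dim \<alpha> TYPE('d))"
  proof -
    have "a powr (2 * \<alpha> + 2) * a ^ CARD('d) = a powr homogeneous_dim \<alpha> TYPE('d)"
      using a by (simp add: homogeneous_dim_def add_ac flip: powr_realpow powr_add)
    then show ?thesis by (simp flip: ennreal_mult')
  qed
  moreover have "(\<integral>\<^sup>+y. g y \<partial>weinstein_measure \<alpha>) =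
      ennreal (1 / weinstein_const \<alpha> TYPE('d)) * (\<integral>\<^sup>+z. H z \<partial>lborel)"
    by (simp add: nn_integral_weinstein_measure H_def)
  ultimately show ?thesis by (simp only: mult.assoc[symmetric]) (simp only: mult_ac)
qed

section \<open>Wavelets and the localization operator\<close>

text \<open>
  Windows are only measurable on the half-space. Extending them by \<open>0\<close> gives Borel functions on the
  whole space, for which joint measurability in all parameters is routine.
\<close>

definition half_space_extension :: "((real ^ 'd::finite) \<times> real \<Rightarrow> complex) \<Rightarrow> (real ^ 'd) \<times> real \<Rightarrow> complex" where
  "half_space_extension \<phi> y = indicator half_space y *\<^sub>R \<phi> y"

lemma half_space_extension_measurable [measurable]:
  fixes \<phi> :: "(real ^ 'd::finite) \<times> real \<Rightarrow> complex"
  assumes "\<phi> \<in> borel_measurable (weinstein_measure \<alpha>)"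
  shows "half_space_extension \<phi> \<in> borel_measurable borel"
proof -
  have "\<phi> \<in> borel_measurable (restrict_space borel half_space)"
    using assms by (simp cong: measurable_cong_sets[OF sets_weinstein_measure refl])
  then have "(\<lambda>y. indicator half_space y *\<^sub>R \<phi> y) \<in> borel_measurable borel"
    by (subst (asm) borel_measurable_restrict_space_iff) auto
  then show ?thesis unfolding half_space_extension_def[abs_def] .
qed

lemma half_space_extension_eq: "y \<in> half_space \<Longrightarrow> half_space_extension \<phi> y = \<phi> y"
  by (simp add: half_space_extension_def)

definition translation_const :: "real \<Rightarrow> real" where
  "translation_const \<alpha> = Gamma (\<alpha> + 1) / (sqrt pi * Gamma (\<alpha> + 1 / 2))"

lemma weinstein_wavelet_eq:
  fixes \<phi> :: "(real ^ 'd::finite) \<times> real \<Rightarrow> complex"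
  assumes \<phi> [measurable]: "\<phi> \<in> borel_measurable (weinstein_measure \<alpha>)"
    and a: "0 < a" and x: "x \<in> half_space" and y: "y \<in> half_space"
  shows "weinstein_wavelet \<alpha> \<phi> a x y =
    of_real (a powr (- (homogeneous_dim \<alpha> TYPE('d) / 2)) * translation_const \<alpha>) *
    (\<integral>\<theta>. half_space_extension \<phi> (angular_shift x y \<theta> /\<^sub>R a) \<partial>angular_measure \<alpha>)"
proof -
  let ?D = "homogeneous_dim \<alpha> TYPE('d)"
  have [measurable]: "half_space_extension \<phi> \<in> borel_measurable borel" using \<phi> by measurable
  have ext: "weinstein_dilation \<alpha> a \<phi> (angular_shift x y \<theta>) =
      of_real (a powr (- ?D)) * half_space_extension \<phi> (angular_shift x y \<theta> /\<^sub>R a)"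
    if "\<theta> \<in> {0<..<pi}" for \<theta>
  proof -
    have "angular_shift x y \<theta> /\<^sub>R a \<in> half_space"
      using angular_shift_half_space[OF x y that] a by (simp add: half_space_def)
    then show ?thesis
      by (simp add: weinstein_dilation_def homogeneous_dim_def half_space_extension_eq)
  qed
  have "(LBINT \<theta>=0..pi. weinstein_dilation \<alpha> a \<phi> (angular_shift x y \<theta>) * of_real (sin \<theta> powr (2 * \<alpha>))) =
      (\<integral>\<theta>. indicator {0<..<pi} \<theta> *\<^sub>R (weinstein_dilation \<alpha> a \<phi> (angular_shift x y \<theta>) * of_real (sin \<theta> powr (2 * \<alpha>))) \<partial>lborel)"
    by (simp add: interval_lebesgue_integral_def set_lebesgue_integral_def zero_ereal_def)
  also have "\<dots> = (\<integral>\<theta>. of_real (a powr (- ?D)) * ((indicator {0<..<pi} \<theta> * sin \<theta> powr (2 * \<alpha>)) *\<^sub>R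
      half_space_extension \<phi> (angular_shift x y \<theta> /\<^sub>R a)) \<partial>lborel)"
    by (intro Bochner_Integration.integral_cong refl)
      (auto simp: ext scaleR_conv_of_real mult_ac split: split_indicator)
  also have "\<dots> = of_real (a powr (- ?D)) * (\<integral>\<theta>. (indicator {0<..<pi} \<theta> * sin \<theta> powr (2 * \<alpha>)) *\<^sub>R
      half_space_extension \<phi> (angular_shift x y \<theta> /\<^sub>R a) \<partial>lborel)"
    by (rule integral_mult_right_zero)
  also have "(\<integral>\<theta>. (indicator {0<..<pi} \<theta> * sin \<theta> powr (2 * \<alpha>)) *\<^sub>R
      half_space_extension \<phi> (angular_shift x y \<theta> /\<^sub>R a) \<partial>lborel) =
      (\<integral>\<theta>. half_space_extension \<phi> (angular_shift x y \<theta> /\<^sub>R a) \<partial>angular_measure \<alpha>)"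
    unfolding angular_measure_def by (rule integral_density[symmetric]) auto
  finally have *: "(LBINT \<theta>=0..pi. weinstein_dilation \<alpha> a \<phi> (angular_shift x y \<theta>) * of_real (sin \<theta> powr (2 * \<alpha>))) =
      of_real (a powr (- ?D)) * (\<integral>\<theta>. half_space_extension \<phi> (angular_shift x y \<theta> /\<^sub>R a) \<partial>angular_measure \<alpha>)" .
  have "\<alpha> + 1 + real CARD('d) / 2 = ?D / 2" by (simp add: homogeneous_dim_def)
  then have "weinstein_wavelet \<alpha> \<phi> a x y = of_real (a powr (?D / 2)) * (of_real (translation_const \<alpha>) *
      (of_real (a powr (- ?D)) * (\<integral>\<theta>. half_space_extension \<phi> (angular_shift x y \<theta> /\<^sub>R a) \<partial>angular_measure \<alpha>)))"
    using * by (simp only: weinstein_wavelet_def weinstein_translation_def translation_const_def angular_shift_def)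
  also have "\<dots> = of_real (a powr (?D / 2) * a powr (- ?D) * translation_const \<alpha>) *
      (\<integral>\<theta>. half_space_extension \<phi> (angular_shift x y \<theta> /\<^sub>R a) \<partial>angular_measure \<alpha>)"
    by (simp only: of_real_mult mult_ac)
  also have "a powr (?D / 2) * a powr (- ?D) = a powr (- (?D / 2))"
    by (simp flip: powr_add)
  finally show ?thesis .
qed

text \<open>
  With \<open>D = homogeneous_dim\<close>, the \<open>L\<^sup>p\<close> norm of \<open>\<psi>\<^bsub>a,x\<^esub>\<close> is at most a multiple of \<open>a\<^bsup>D (1/p - 1/2)\<^esup>\<close>. The factor below
  compensates this. For conjugate exponents the factors of the two windows are reciprocal, so that
  normalising both leaves the localization operator unchanged.
\<close>

definition normalised_wavelet ::
    "real \<Rightarrow> ennreal \<Rightarrow> ((real ^ 'd::finite) \<times> real \<Rightarrow> complex) \<Rightarrow> real \<times> ((real ^ 'd) \<times> real)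
      \<Rightarrow> (real ^ 'd) \<times> real \<Rightarrow> complex" where
  "normalised_wavelet \<alpha> p \<phi> = (\<lambda>(a, x) y.
     of_real (a powr (homogeneous_dim \<alpha> TYPE('d) * (1 / 2 - enn2real (1 / p)))) * weinstein_wavelet \<alpha> \<phi> a x y)"

lemma normalised_wavelet_eq:
  fixes \<phi> :: "(real ^ 'd::finite) \<times> real \<Rightarrow> complex"
  assumes "\<phi> \<in> borel_measurable (weinstein_measure \<alpha>)" "0 < a" "x \<in> half_space" "y \<in> half_space"
  shows "normalised_wavelet \<alpha> p \<phi> (a, x) y =
    of_real (a powr (- (homogeneous_dim \<alpha> TYPE('d) * enn2real (1 / p))) * translation_const \<alpha>) *
    (\<integral>\<theta>. half_space_extension \<phi> (angular_shift x y \<theta> /\<^sub>R a) \<partial>angular_measure \<alpha>)"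
proof -
  let ?D = "homogeneous_dim \<alpha> TYPE('d)"
  have "a powr (?D * (1 / 2 - enn2real (1 / p))) * a powr (- (?D / 2)) = a powr (- (?D * enn2real (1 / p)))"
    by (simp add: algebra_simps flip: powr_add)
  then show ?thesis
    unfolding normalised_wavelet_def prod.case weinstein_wavelet_eq[OF assms]
    by (simp only: mult.assoc[symmetric] of_real_mult[symmetric])
qed

lemma weinstein_ident_measurable:
  "(\<lambda>y. y) \<in> (weinstein_measure \<alpha> :: ((real ^ 'd::finite) \<times> real) measure) \<rightarrow>\<^sub>M borel"
  unfolding measurable_cong_sets[OF sets_weinstein_measure refl]
  by (rule measurable_restrict_space1) simp

lemma wavelet_ident_measurable:
  "(\<lambda>\<xi>. \<xi>) \<in> (weinstein_wavelet_measure \<alpha> :: (real \<times> ((real ^ 'd::finite) \<times> real)) measure) \<rightarrow>\<^sub>M borel"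
  unfolding measurable_cong_sets[OF sets_weinstein_wavelet_measure refl]
  by (rule measurable_restrict_space1) simp

lemma normalised_wavelet_measurable:
  fixes \<phi> :: "(real ^ 'd::finite) \<times> real \<Rightarrow> complex"
  assumes \<alpha>: "\<alpha> > - 1 / 2" and \<phi>: "\<phi> \<in> borel_measurable (weinstein_measure \<alpha>)"
  shows "(\<lambda>(\<xi>, y). normalised_wavelet \<alpha> p \<phi> \<xi> y) \<in>
    borel_measurable (weinstein_wavelet_measure \<alpha> \<Otimes>\<^sub>M weinstein_measure \<alpha>)"
proof -
  interpret A: finite_measure "angular_measure \<alpha>" by (rule finite_angular_measure[OF \<alpha>])
  have [measurable]: "half_space_extension \<phi> \<in> borel_measurable borel" using \<phi> by measurable
  note [measurable] = weinstein_ident_measurable[of \<alpha>, where 'd='d] wavelet_ident_measurable[of \<alpha>, where 'd='d]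
  let ?NM = "(weinstein_wavelet_measure \<alpha> :: (real \<times> ((real ^ 'd) \<times> real)) measure) \<Otimes>\<^sub>M
    (weinstein_measure \<alpha> :: ((real ^ 'd) \<times> real) measure)"
  have [measurable]: "fst \<in> borel_measurable ?NM" "snd \<in> borel_measurable ?NM"
    using measurable_compose[OF measurable_fst wavelet_ident_measurable]
      measurable_compose[OF measurable_snd weinstein_ident_measurable] by auto
  let ?W = "\<lambda>z :: (real \<times> ((real ^ 'd) \<times> real)) \<times> ((real ^ 'd) \<times> real).
    of_real (fst (fst z) powr (- (homogeneous_dim \<alpha> TYPE('d) * enn2real (1 / p))) * translation_const \<alpha>) *
    (\<integral>\<theta>. half_space_extension \<phi> (angular_shift (snd (fst z)) (snd z) \<theta> /\<^sub>R fst (fst z)) \<partial>angular_measure \<alpha>)"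
  have "?W \<in> borel_measurable ?NM"
    by measurable
  moreover have "(case z of (\<xi>, y) \<Rightarrow> normalised_wavelet \<alpha> p \<phi> \<xi> y) = ?W z" if "z \<in> space ?NM" for z
    using that \<phi> by (cases z, cases "fst z") (auto simp: space_pair_measure normalised_wavelet_eq)
  ultimately show ?thesis by (subst measurable_cong) auto
qed

text \<open>
  Jensen's inequality moves the \<open>p\<close>-th power inside the average over \<open>\<theta>\<close>; the invariance of \<open>\<mu>\<^sub>\<alpha>\<close> under
  the generalized translation and its homogeneity under dilations then compute the integral, and all
  powers of \<open>a\<close> cancel. For \<open>p = \<infinity>\<close> the same two facts, applied to the indicator of the exceptional
  null set, show that for almost every \<open>y\<close> the average only meets values bounded by \<open>B\<close>.
\<close>

lemma normalised_wavelet_bounded: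
  fixes \<phi> :: "(real ^ 'd::finite) \<times> real \<Rightarrow> complex"
  assumes \<alpha>: "\<alpha> > - 1 / 2" and p: "1 \<le> p" and \<phi>: "\<phi> \<in> Lp_space (weinstein_measure \<alpha>) p"
  shows "\<exists>A. \<forall>\<xi> \<in> space (weinstein_wavelet_measure \<alpha>).
    Lp_bounded (weinstein_measure \<alpha>) p A (normalised_wavelet \<alpha> p \<phi> \<xi>)"
proof -
  let ?D = "homogeneous_dim \<alpha> TYPE('d)"
  let ?M = "weinstein_measure \<alpha> :: ((real ^ 'd) \<times> real) measure"
  let ?\<Theta> = "angular_measure \<alpha>"
  let ?c = "translation_const \<alpha>"
  have \<phi>m: "\<phi> \<in> borel_measurable ?M" using \<phi> by (simp add: Lp_space_def)
  define \<phi>' where "\<phi>' = half_space_extension \<phi>"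
  have [measurable]: "\<phi>' \<in> borel_measurable borel" unfolding \<phi>'_def using \<phi>m by measurable
  interpret A: finite_measure ?\<Theta> by (rule finite_angular_measure[OF \<alpha>])
  note [measurable] = weinstein_ident_measurable[of \<alpha>, where 'd='d]
  define m where "m = measure ?\<Theta> (space ?\<Theta>)"
  have eq: "normalised_wavelet \<alpha> p \<phi> (a, x) y = of_real (a powr (- (?D * enn2real (1 / p))) * ?c) *
      (\<integral>\<theta>. \<phi>' (angular_shift x y \<theta> /\<^sub>R a) \<partial>?\<Theta>)"
    if "0 < a" "x \<in> half_space" "y \<in> half_space" for a x y
    unfolding \<phi>'_def by (rule normalised_wavelet_eq[OF \<phi>m that])
  have meas: "normalised_wavelet \<alpha> p \<phi> (a, x) \<in> borel_measurable ?M" if "0 < a" "x \<in> half_space" for a x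
  proof -
    have "(\<lambda>y. of_real (a powr (- (?D * enn2real (1 / p))) * ?c) *
      (\<integral>\<theta>. \<phi>' (angular_shift x y \<theta> /\<^sub>R a) \<partial>?\<Theta>)) \<in> borel_measurable ?M" by measurable
    then show ?thesis by (subst measurable_cong[OF eq[OF that]]) auto
  qed
  have orbit: "(\<integral>\<^sup>+y. (\<integral>\<^sup>+\<theta>. g (angular_shift x y \<theta> /\<^sub>R a) \<partial>?\<Theta>) \<partial>?M) =
      angular_mass \<alpha> * (ennreal (a powr ?D) * (\<integral>\<^sup>+y. g y \<partial>?M))"
    if "0 < a" and [measurable]: "g \<in> borel_measurable borel" for g a x
    using nn_integral_weinstein_translation[of "\<lambda>z. g (z /\<^sub>R a)" \<alpha> x]
      nn_integral_weinstein_dilation[of g a \<alpha>] that by simp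
  show ?thesis
  proof (cases "p = \<infinity>")
    case True
    obtain B where B: "Lp_bounded ?M p B \<phi>"
      using Lp_space_imp_Lp_bounded[OF p \<phi> order_refl] by blast
    have "Lp_bounded ?M p (\<bar>?c\<bar> * (B * m)) (normalised_wavelet \<alpha> p \<phi> (a, x))"
      if a: "0 < a" and x: "x \<in> half_space" for a x
    proof -
      \<comment> \<open>The set where the bound on \<open>\<phi>\<close> fails is null, so it meets almost no orbit \<open>\<theta> \<mapsto> angular_shift x y \<theta>\<close> in positive mass.\<close>
      let ?g = "\<lambda>y. indicator {y. \<not> norm (\<phi>' y) \<le> B} y :: ennreal"
      have [measurable]: "?g \<in> borel_measurable borel" by measurable
      have "AE y in ?M. norm (\<phi> y) \<le> B" using B True by (simp add: Lp_bounded_def)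
      then have "AE y in ?M. ?g y = 0"
        using AE_space by eventually_elim (simp add: \<phi>'_def half_space_extension_eq)
      then have "(\<integral>\<^sup>+y. ?g y \<partial>?M) = 0" by (subst nn_integral_0_iff_AE) auto
      then have "(\<integral>\<^sup>+y. (\<integral>\<^sup>+\<theta>. ?g (angular_shift x y \<theta> /\<^sub>R a) \<partial>?\<Theta>) \<partial>?M) = 0"
        by (subst orbit[OF a]) auto
      then have "AE y in ?M. (\<integral>\<^sup>+\<theta>. ?g (angular_shift x y \<theta> /\<^sub>R a) \<partial>?\<Theta>) = 0"
        by (subst (asm) nn_integral_0_iff_AE) auto
      then have "AE y in ?M. norm (normalised_wavelet \<alpha> p \<phi> (a, x) y) \<le> \<bar>?c\<bar> * (B * m)"
        using AE_space
      proof eventually_elim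
        case (elim y)
        have "AE \<theta> in ?\<Theta>. ?g (angular_shift x y \<theta> /\<^sub>R a) = 0"
          using elim(1) by (subst (asm) nn_integral_0_iff_AE) auto
        then have ae: "AE \<theta> in ?\<Theta>. norm (\<phi>' (angular_shift x y \<theta> /\<^sub>R a)) \<le> B"
          by eventually_elim (simp split: split_indicator_asm)
        have "norm (\<integral>\<theta>. 1 * \<phi>' (angular_shift x y \<theta> /\<^sub>R a) \<partial>?\<Theta>) \<le> B * (\<integral>\<theta>. norm (1 :: complex) \<partial>?\<Theta>)"
          by (rule integrable_mult_AE_bounded(2)[OF _ _ ae]) auto
        then have le: "norm (\<integral>\<theta>. \<phi>' (angular_shift x y \<theta> /\<^sub>R a) \<partial>?\<Theta>) \<le> B * m"
          by (simp add: m_def)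
        have "normalised_wavelet \<alpha> p \<phi> (a, x) y = of_real ?c * (\<integral>\<theta>. \<phi>' (angular_shift x y \<theta> /\<^sub>R a) \<partial>?\<Theta>)"
          using eq[OF a x] elim(2) a True by (simp add: divide_ennreal_def)
        then show ?case using le by (simp add: norm_mult mult_left_mono)
      qed
      then show ?thesis using meas[OF a x] True by (simp add: Lp_bounded_def)
    qed
    then show ?thesis by (intro exI[of _ "\<bar>?c\<bar> * (B * m)"]) auto
  next
    case False
    then obtain b where b: "p = ennreal b" "0 \<le> b" by (cases p) auto
    with p have b1: "1 \<le> b" by (simp flip: ennreal_1)
    have invp: "enn2real (1 / p) = 1 / b" using b b1 by (simp add: divide_ennreal flip: ennreal_1)
    define I where "I = (\<integral>\<^sup>+y. ennreal (norm (\<phi>' y) powr b) \<partial>?M)"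
    have "I = (\<integral>\<^sup>+y. ennreal (norm (\<phi> y) powr b) \<partial>?M)"
      unfolding I_def \<phi>'_def by (intro nn_integral_cong) (simp add: half_space_extension_eq)
    also have "\<dots> < \<infinity>" using \<phi> b False by (simp add: Lp_space_def integrable_iff_bounded)
    finally have I: "I < \<infinity>" .
    define R where "R = ennreal (\<bar>?c\<bar> powr b) * (ennreal (m powr (b - 1)) * (angular_mass \<alpha> * I))"
    have R: "R < \<infinity>"
      using I angular_mass_finite[OF \<alpha>] by (simp add: R_def ennreal_mult_less_top)
    have "Lp_bounded ?M p (enn2real R) (normalised_wavelet \<alpha> p \<phi> (a, x))"
      if a: "0 < a" and x: "x \<in> half_space" for a x
    proof -
      let ?E = "ennreal (\<bar>?c\<bar> powr b * a powr (- ?D))"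
      let ?J = "\<lambda>y. \<integral>\<^sup>+\<theta>. ennreal (norm (\<phi>' (angular_shift x y \<theta> /\<^sub>R a)) powr b) \<partial>?\<Theta>"
      have "(\<integral>\<^sup>+y. ennreal (norm (normalised_wavelet \<alpha> p \<phi> (a, x) y) powr b) \<partial>?M) \<le>
          (\<integral>\<^sup>+y. ?E * (ennreal (m powr (b - 1)) * ?J y) \<partial>?M)"
      proof (rule nn_integral_mono)
        fix y assume "y \<in> space ?M"
        then have y: "y \<in> half_space" by simp
        let ?z = "\<integral>\<theta>. \<phi>' (angular_shift x y \<theta> /\<^sub>R a) \<partial>?\<Theta>"
        have "norm (normalised_wavelet \<alpha> p \<phi> (a, x) y) = (a powr (- (?D / b)) * \<bar>?c\<bar>) * norm ?z"
          unfolding eq[OF a x y] invp by (simp add: norm_mult abs_mult)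
        also have "\<dots> powr b = (a powr (- (?D / b)) * \<bar>?c\<bar>) powr b * norm ?z powr b"
          by (simp add: powr_mult)
        also have "(a powr (- (?D / b)) * \<bar>?c\<bar>) powr b = \<bar>?c\<bar> powr b * a powr (- ?D)"
          using b1 by (simp add: powr_mult powr_powr)
        finally have "ennreal (norm (normalised_wavelet \<alpha> p \<phi> (a, x) y) powr b) = ?E * ennreal (norm ?z powr b)"
          by (simp add: ennreal_mult')
        also have "\<dots> \<le> ?E * (ennreal (m powr (b - 1)) * ?J y)"
          unfolding m_def
          by (intro mult_left_mono norm_integral_powr_le[OF A.finite_measure_axioms b1]) auto
        finally show "ennreal (norm (normalised_wavelet \<alpha> p \<phi> (a, x) y) powr b) \<le>
            ?E * (ennreal (m powr (b - 1)) * ?J y)" .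
      qed
      also have "\<dots> = ?E * (ennreal (m powr (b - 1)) * (\<integral>\<^sup>+y. ?J y \<partial>?M))"
        by (simp add: nn_integral_cmult)
      also have "(\<integral>\<^sup>+y. ?J y \<partial>?M) = angular_mass \<alpha> * (ennreal (a powr ?D) * I)"
        unfolding I_def by (rule orbit[OF a]) measurable
      also have "?E * (ennreal (m powr (b - 1)) * (angular_mass \<alpha> * (ennreal (a powr ?D) * I))) =
          (?E * ennreal (a powr ?D)) * (ennreal (m powr (b - 1)) * (angular_mass \<alpha> * I))"
        by (simp only: mult_ac)
      also have "?E * ennreal (a powr ?D) = ennreal (\<bar>?c\<bar> powr b)"
      proof -
        have "\<bar>?c\<bar> powr b * a powr (- ?D) * a powr ?D = \<bar>?c\<bar> powr b"
          using a by (simp add: mult.assoc flip: powr_add)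
        then show ?thesis by (simp flip: ennreal_mult')
      qed
      also have "ennreal (\<bar>?c\<bar> powr b) * (ennreal (m powr (b - 1)) * (angular_mass \<alpha> * I)) = ennreal (enn2real R)"
        using R by (simp add: R_def)
      finally show ?thesis using meas[OF a x] b False by (simp add: Lp_bounded_def)
    qed
    then show ?thesis by (intro exI[of _ "enn2real R"]) auto
  qed
qed

lemma borel_measurable_cnj_comp [measurable]:
  assumes "f \<in> borel_measurable M" shows "(\<lambda>x. cnj (f x)) \<in> borel_measurable M"
  by (rule measurable_compose[OF assms]) (intro borel_measurable_continuous_onI continuous_intros)

lemma Lp_bounded_cnj: "Lp_bounded M p C f \<Longrightarrow> Lp_bounded M p C (\<lambda>x. cnj (f x))"
  by (auto simp: Lp_bounded_def)

theorem theorem3p13: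
  fixes \<alpha> :: real and p q :: ennreal
    and \<sigma> :: "real \<times> ((real ^ 'd::finite) \<times> real) \<Rightarrow> complex"
    and \<phi> \<psi> :: "(real ^ 'd) \<times> real \<Rightarrow> complex"
  assumes "\<alpha> > - 1 / 2"
    and "1 \<le> p" and "1 / p + 1 / q = 1"
    and "\<sigma> \<in> Lp_space (weinstein_wavelet_measure \<alpha>) 1"
    and "\<psi> \<in> Lp_space (weinstein_measure \<alpha>) p"
    and "\<phi> \<in> Lp_space (weinstein_measure \<alpha>) q"
  shows "compact_operator_Lp (weinstein_measure \<alpha>) p (localization_operator \<alpha> \<phi> \<psi> \<sigma>)"
proof -
  let ?M = "weinstein_measure \<alpha> :: ((real ^ 'd) \<times> real) measure"
  let ?N = "weinstein_wavelet_measure \<alpha> :: (real \<times> ((real ^ 'd) \<times> real)) measure"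
  let ?D = "homogeneous_dim \<alpha> TYPE('d)"
  let ?P = "\<lambda>\<xi> y. cnj (normalised_wavelet \<alpha> q \<phi> \<xi> y)" and ?Q = "normalised_wavelet \<alpha> p \<psi>"
  have inv: "1 \<le> q \<and> enn2real (1 / p) + enn2real (1 / q) = 1"
    using assms(2,3)
  proof (cases rule: conjugate_exponent_cases)
    case (mid p' q')
    then show ?thesis by (simp add: divide_ennreal flip: ennreal_1)
  qed (auto simp: divide_ennreal_def)
  obtain A where A: "\<And>\<xi>. \<xi> \<in> space ?N \<Longrightarrow> Lp_bounded ?M q A (normalised_wavelet \<alpha> q \<phi> \<xi>)"
    using normalised_wavelet_bounded[OF assms(1) conjunct1[OF inv] assms(6)] by blast
  obtain B where B: "\<And>\<xi>. \<xi> \<in> space ?N \<Longrightarrow> Lp_bounded ?M p B (?Q \<xi>)"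
    using normalised_wavelet_bounded[OF assms(1,2,5)] by blast
  have \<phi>m: "\<phi> \<in> borel_measurable ?M" and \<psi>m: "\<psi> \<in> borel_measurable ?M"
    using assms(5,6) by (auto simp: Lp_space_def)
  have s: "integrable ?N \<sigma>"
    using assms(4) by (auto simp: Lp_space_def integrable_norm_iff)
  \<comment> \<open>The transform pairs \<open>f\<close> with the conjugate of the wavelet; the bilinear pairing of the locale absorbs this in \<open>?P\<close>.\<close>
  interpret K: kernel_family ?M ?N p q \<sigma> ?P ?Q A B
  proof (rule kernel_family.intro)
    show "sigma_finite_measure ?M" by (rule sigma_finite_weinstein_measure)
    show "sigma_finite_measure ?N" by (rule sigma_finite_weinstein_wavelet_measure)
    have "(\<lambda>z. cnj (case z of (\<xi>, y) \<Rightarrow> normalised_wavelet \<alpha> q \<phi> \<xi> y)) \<in> borel_measurable (?N \<Otimes>\<^sub>M ?M)"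
      by (intro borel_measurable_cnj_comp normalised_wavelet_measurable assms(1) \<phi>m)
    then have Pm: "(\<lambda>(\<xi>, y). ?P \<xi> y) \<in> borel_measurable (?N \<Otimes>\<^sub>M ?M)"
      by (simp add: case_prod_beta')
    show "kernel_family_axioms ?M ?N p q \<sigma> ?P ?Q A B"
      by (intro kernel_family_axioms.intro assms(2,3) countably_generated_weinstein_measure
          countably_generated_weinstein_wavelet_measure s Pm
          normalised_wavelet_measurable[OF assms(1) \<psi>m] Lp_bounded_cnj A B)
  qed
  have "localization_operator \<alpha> \<phi> \<psi> \<sigma> f y = K.superposition f y" for f y
    unfolding localization_operator_def K.superposition_def
  proof (rule Bochner_Integration.integral_cong[OF refl])
    fix \<xi> assume "\<xi> \<in> space ?N"
    then obtain a x where \<xi>: "\<xi> = (a, x)" and a: "0 < a" by auto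
    let ?u = "a powr (?D * (1 / 2 - enn2real (1 / q)))" and ?v = "a powr (?D * (1 / 2 - enn2real (1 / p)))"
    have "K.coeff f \<xi> = (\<integral>z. f z * cnj (normalised_wavelet \<alpha> q \<phi> \<xi> z) \<partial>?M)"
      by (rule K.coeff_def)
    also have "\<dots> = (\<integral>z. of_real ?u * (f z * cnj (weinstein_wavelet \<alpha> \<phi> a x z)) \<partial>?M)"
      unfolding \<xi> normalised_wavelet_def
      by (intro Bochner_Integration.integral_cong refl) (simp add: mult_ac)
    also have "\<dots> = of_real ?u * weinstein_transform \<alpha> \<phi> f (a, x)"
      unfolding weinstein_transform_def prod.case by (rule integral_mult_right_zero)
    finally have c: "K.coeff f \<xi> = of_real ?u * weinstein_transform \<alpha> \<phi> f (a, x)" .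
    have "?D * (1 / 2 - enn2real (1 / q)) + ?D * (1 / 2 - enn2real (1 / p)) =
        ?D * (1 - (enn2real (1 / p) + enn2real (1 / q)))" by (simp add: algebra_simps)
    also have "\<dots> = 0" using inv by simp
    finally have "?u * ?v = 1" using a by (simp flip: powr_add)
    then have uv: "of_real ?u * of_real ?v = (1 :: complex)" by (metis of_real_1 of_real_mult)
    have "\<sigma> \<xi> * K.coeff f \<xi> * ?Q \<xi> y = (of_real ?u * of_real ?v) *
        (\<sigma> (a, x) * weinstein_transform \<alpha> \<phi> f (a, x) * weinstein_wavelet \<alpha> \<psi> a x y)"
      unfolding c unfolding \<xi> normalised_wavelet_def prod.case by (simp only: mult_ac)
    then show "(case \<xi> of (a, x) \<Rightarrow> \<sigma> (a, x) * weinstein_transform \<alpha> \<phi> f (a, x) * weinstein_wavelet \<alpha> \<psi> a x y) =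
        \<sigma> \<xi> * K.coeff f \<xi> * ?Q \<xi> y"
      unfolding uv \<xi> prod.case mult_1_left by (rule sym)
  qed
  then have "localization_operator \<alpha> \<phi> \<psi> \<sigma> = K.superposition" by (intro ext)
  then show ?thesis using K.superposition_compact by simp
qed

end
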